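(* Let $\mathscr{H}$ be a Hilbert $W^*$-module over a $W^*$-algebra $\mathfrak{A}$ and let its dual $\mathscr{H}'$ be a relative reproducing kernel Hilbert $C^*$-module of $\mathscr{E}$-valued functions on a set $S$ with a relative reproducing kernel $D$. If there is $s_0\in S$ such that for each $x\in\mathscr{E}$ the $\mathfrak{A}$-linear map $f\mapsto\langle x,f(s_0)\rangle$ on $\mathscr{H}'$ is continuous, then $\mathscr{H}'$ is a reproducing kernel Hilbert $C^*$-module with a kernel $K:S\times S\to\mathcal{L}(\mathscr{E})$. Moreover, $D_{x,s,t}=K_{x,s}-K_{x,t}$ for all $x\in\mathscr{E}$, $s,t\in S$, where $K_{x,s}(t):=K(s,t)(x)$.
   Context: $\mathscr{E}$ is a Hilbert $C^*$-module over $\mathfrak{A}$; Hilbert modules are right modules with inner product linear in the second variable. $\mathcal{L}(\mathscr{E})$ is the $C^*$-algebra of adjointable operators on $\mathscr{E}$. A Hilbert $W^*$-module is a Hilbert $C^*$-module over a $W^*$-algebra. Dual: $\mathscr{H}'$ is the space of bounded $\mathfrak{A}$-module maps $\mathscr{H}\to\mathfrak{A}$, a right $\mathfrak{A}$-module under $(\lambda f+g)(x)=\overline{\lambda}f(x)+g(x)$ and $(f\cdot a)(x)=a^*f(x)$; $\mathscr{H}$ embeds in $\mathscr{H}'$ by $x\mapsto\hat x=\langle x,\cdot\rangle$. For a $W^*$-algebra $\mathfrak{A}$ the inner product of $\mathscr{H}$ extends to an $\mathfrak{A}$-valued inner product on $\mathscr{H}'$ making $\mathscr{H}'$ a self-dual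 Hilbert $\mathfrak{A}$-module (every bounded $\mathfrak{A}$-linear map $\mathscr{H}'\to\mathfrak{A}$ is of the form $\langle\psi,\cdot\rangle$ with $\psi\in\mathscr{H}'$), with $\langle\tau,\hat x\rangle=\tau(x)$ for $\tau\in\mathscr{H}'$, $x\in\mathscr{H}$; $\mathscr{H}'$ is taken with this structure. Modules of $\mathscr{E}$-valued functions on $S$ carry the pointwise linear operations and the action $(f\cdot a)(s)=f(s)a$. A Hilbert $\mathfrak{A}$-module $\mathscr{M}$ of $\mathscr{E}$-valued functions on $S$ is a relative reproducing kernel Hilbert $C^*$-module with relative reproducing kernel $D$ if $D:\mathscr{E}\times S\times S\to\mathscr{M}$, $(x,s,t)\mapsto D_{x,s,t}$, satisfies $\langle f(s)-f(t),x\rangle=\langle f,D_{x,s,t}\rangle$ for all $f\in\mathscr{M}$, $x\in\mathscr{E}$, $s,t\in S$. A kernel is a map $K:S\times S\to\mathcal{L}(\mathscr{E})$; a (hermitian, i.e. $K(t,s)=K(s,t)^*$) kernel is positive definite if $\sum_{i,j=1}^n\langle K(s_i,s_j)x_i,x_j\rangle\ge0$ for all $n\ge2$, $s_i\in S$, $x_i\in\mathscr{E}$. A Hilbert $\mathfrak{A}$-module $\mathscr{M}$ of $\mathscr{E}$-valued functions on $S$ is the reproducing kernel Hilbert $C^*$-module with (positive definite) kernel $K$ if the functions $K_{x,s}(t):=K(s,t)(x)$ belong to $\mathscr{M}$ for all $x\in\mathscr{E}$, $s\in S$, have dense $\mathfrak{A}$-linear span in $\mathscr{M}$, satisfy $\langle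 K_{x,s},K_{y,t}\rangle=\langle K(s,t)x,y\rangle$, and $\langle f(s),x\rangle=\langle f,K_{x,s}\rangle$ for all $f\in\mathscr{M}$, $x\in\mathscr{E}$, $s\in S$.
   Formalization: The span of the K_{x,s} is shown dense in the weak* topology of H', not in norm; norm density fails in general, e.g. for H'=ℓ^∞ over ℓ^∞ seen as functions s↦f(s)e_s into E=c₀, where the span only has norm closure c₀. For Hilbert spaces the two notions agree. *)

theory Defs
  imports "HOL-Analysis.Analysis" "HOL-Library.Function_Algebras"
begin

section \<open>\<open>C\<^sup>*\<close>-algebras and \<open>W\<^sup>*\<close>-algebras\<close>

class complex_vector = real_vector +
  fixes scaleC :: "complex \<Rightarrow> 'a \<Rightarrow> 'a"  (infixr \<open>*\<^sub>C\<close> 75)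
  assumes scaleC_add_right: "c *\<^sub>C (x + y) = c *\<^sub>C x + c *\<^sub>C y"
    and scaleC_add_left: "(c + d) *\<^sub>C x = c *\<^sub>C x + d *\<^sub>C x"
    and scaleC_scaleC: "c *\<^sub>C d *\<^sub>C x = (c * d) *\<^sub>C x"
    and scaleC_one: "1 *\<^sub>C x = x"
    and scaleR_scaleC: "scaleR r x = complex_of_real r *\<^sub>C x"

class cstar_algebra = complex_vector + real_normed_algebra + banach +
  fixes star :: "'a \<Rightarrow> 'a"
  assumes norm_scaleC: "norm (c *\<^sub>C a) = cmod c * norm a"
    and scaleC_mult_left: "(c *\<^sub>C a) * b = c *\<^sub>C (a * b)"
    and scaleC_mult_right: "a * (c *\<^sub>C b) = c *\<^sub>C (a * b)"
    and star_star: "star (star a) = a"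
    and star_add: "star (a + b) = star a + star b"
    and star_mult: "star (a * b) = star b * star a"
    and star_scaleC: "star (c *\<^sub>C a) = cnj c *\<^sub>C star a"
    and cstar_identity: "norm (star a * a) = (norm a)\<^sup>2"

definition positive :: "'a::cstar_algebra \<Rightarrow> bool" where
  "positive a \<longleftrightarrow> (\<exists>b. a = star b * b)"

text \<open>
  A \<open>W\<^sup>*\<close>-algebra in the sense of Sakai: a \<open>C\<^sup>*\<close>-algebra that is (isometrically) the dual of a Banach
  space. The predual is represented by its canonical image \<open>P\<close>, a norm-closed complex subspace of
  the dual Banach space of the algebra (the type \<open>'a \<Rightarrow>\<^sub>L complex\<close> consists of the bounded
  \<^emph>\<open>real\<close>-linear maps, hence the first clause). The last two clauses say that evaluation is a
  surjective isometry from the algebra onto the dual of \<open>P\<close>. The existence of a unit, which holds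
  automatically, is included in the definition.
\<close>
definition wstar_predual :: "('a::cstar_algebra \<Rightarrow>\<^sub>L complex) set \<Rightarrow> bool" where
  "wstar_predual P \<longleftrightarrow>
     (\<forall>\<phi>\<in>P. \<forall>c a. blinfun_apply \<phi> (c *\<^sub>C a) = c * blinfun_apply \<phi> a) \<and>
     0 \<in> P \<and> (\<forall>\<phi>\<in>P. \<forall>\<psi>\<in>P. \<phi> + \<psi> \<in> P) \<and>
     (\<forall>\<phi>\<in>P. \<forall>c. \<exists>\<psi>\<in>P. \<forall>a. blinfun_apply \<psi> a = c * blinfun_apply \<phi> a) \<and>
     closed P \<and>
     (\<exists>e::'a. \<forall>a. e * a = a \<and> a * e = a) \<and>
     (\<forall>a. norm a = (SUP \<phi>\<in>{\<phi>\<in>P. norm \<phi> \<le> 1}. cmod (blinfun_apply \<phi> a))) \<and>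
     (\<forall>F :: ('a \<Rightarrow>\<^sub>L complex) \<Rightarrow> complex.
        (\<forall>\<phi>\<in>P. \<forall>\<psi>\<in>P. F (\<phi> + \<psi>) = F \<phi> + F \<psi>) \<longrightarrow>
        (\<forall>\<phi>\<in>P. \<forall>\<psi>\<in>P. \<forall>c. (\<forall>a. blinfun_apply \<psi> a = c * blinfun_apply \<phi> a) \<longrightarrow> F \<psi> = c * F \<phi>) \<longrightarrow>
        (\<exists>C. \<forall>\<phi>\<in>P. cmod (F \<phi>) \<le> C * norm \<phi>) \<longrightarrow>
        (\<exists>a. \<forall>\<phi>\<in>P. F \<phi> = blinfun_apply \<phi> a))"


section \<open>Hilbert modules\<close>

definition ip_norm :: "('v \<Rightarrow> 'v \<Rightarrow> 'a::cstar_algebra) \<Rightarrow> 'v \<Rightarrow> real" where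
  "ip_norm ip x = sqrt (norm (ip x x))"

text \<open>The value \<open>0\<close> outside \<open>V\<close> makes the distance symmetric everywhere, as \<^locale>\<open>Metric_space\<close> demands.\<close>
definition ip_dist ::
  "'v::ab_group_add set \<Rightarrow> ('v \<Rightarrow> 'v \<Rightarrow> 'a::cstar_algebra) \<Rightarrow> 'v \<Rightarrow> 'v \<Rightarrow> real" where
  "ip_dist V ip x y = (if x \<in> V \<and> y \<in> V then ip_norm ip (x - y) else 0)"

definition submodule ::
  "(complex \<Rightarrow> 'v \<Rightarrow> 'v) \<Rightarrow> ('v \<Rightarrow> 'a \<Rightarrow> 'v) \<Rightarrow> 'v::ab_group_add set \<Rightarrow> bool" where
  "submodule sc act N \<longleftrightarrow>
     0 \<in> N \<and> (\<forall>x\<in>N. \<forall>y\<in>N. x + y \<in> N) \<and> (\<forall>x\<in>N. \<forall>c. sc c x \<in> N) \<and> (\<forall>x\<in>N. \<forall>a. act x a \<in> N)"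

text \<open>
  Carrier, scalar multiplication, right action and inner product are explicit parameters, because
  the dual module carries a scalar multiplication and an action that are not the pointwise ones.
\<close>
locale hilbert_module =
  fixes V :: "'v::ab_group_add set"
    and sc :: "complex \<Rightarrow> 'v \<Rightarrow> 'v"
    and act :: "'v \<Rightarrow> 'a::cstar_algebra \<Rightarrow> 'v"
    and ip :: "'v \<Rightarrow> 'v \<Rightarrow> 'a"
  assumes closed_operations: "submodule sc act V"
    and sc_add_right: "x \<in> V \<Longrightarrow> y \<in> V \<Longrightarrow> sc c (x + y) = sc c x + sc c y"
    and sc_add_left: "x \<in> V \<Longrightarrow> sc (c + d) x = sc c x + sc d x"
    and sc_sc: "x \<in> V \<Longrightarrow> sc c (sc d x) = sc (c * d) x"
    and sc_one: "x \<in> V \<Longrightarrow> sc 1 x = x"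
    and act_add_left: "x \<in> V \<Longrightarrow> y \<in> V \<Longrightarrow> act (x + y) a = act x a + act y a"
    and act_add_right: "x \<in> V \<Longrightarrow> act x (a + b) = act x a + act x b"
    and act_mult: "x \<in> V \<Longrightarrow> act x (a * b) = act (act x a) b"
    and act_sc: "x \<in> V \<Longrightarrow> act (sc c x) a = sc c (act x a)"
    and act_scaleC: "x \<in> V \<Longrightarrow> act x (c *\<^sub>C a) = sc c (act x a)"
    and ip_add: "x \<in> V \<Longrightarrow> y \<in> V \<Longrightarrow> z \<in> V \<Longrightarrow> ip x (y + z) = ip x y + ip x z"
    and ip_sc: "x \<in> V \<Longrightarrow> y \<in> V \<Longrightarrow> ip x (sc c y) = c *\<^sub>C ip x y"
    and ip_act: "x \<in> V \<Longrightarrow> y \<in> V \<Longrightarrow> ip x (act y a) = ip x y * a"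
    and ip_star: "x \<in> V \<Longrightarrow> y \<in> V \<Longrightarrow> star (ip x y) = ip y x"
    and ip_positive: "x \<in> V \<Longrightarrow> positive (ip x x)"
    and ip_definite: "x \<in> V \<Longrightarrow> ip x x = 0 \<Longrightarrow> x = 0"
    and complete: "Metric_space.mcomplete V (ip_dist V ip)"

definition bounded_module_map ::
  "'v::ab_group_add set \<Rightarrow> (complex \<Rightarrow> 'v \<Rightarrow> 'v) \<Rightarrow> ('v \<Rightarrow> 'a::cstar_algebra \<Rightarrow> 'v) \<Rightarrow>
   ('v \<Rightarrow> 'v \<Rightarrow> 'a) \<Rightarrow> ('v \<Rightarrow> 'a) \<Rightarrow> bool" where
  "bounded_module_map V sc act ip F \<longleftrightarrow>
     (\<forall>x\<in>V. \<forall>y\<in>V. F (x + y) = F x + F y) \<and>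
     (\<forall>x\<in>V. \<forall>c. F (sc c x) = c *\<^sub>C F x) \<and>
     (\<forall>x\<in>V. \<forall>a. F (act x a) = F x * a) \<and>
     (\<exists>C. \<forall>x\<in>V. norm (F x) \<le> C * ip_norm ip x)"

definition is_adjoint ::
  "('e \<Rightarrow> 'e \<Rightarrow> 'a) \<Rightarrow> ('e \<Rightarrow> 'e) \<Rightarrow> ('e \<Rightarrow> 'e) \<Rightarrow> bool" where
  "is_adjoint ip T T' \<longleftrightarrow> (\<forall>x y. ip (T x) y = ip x (T' y))"

definition adjointable :: "('e \<Rightarrow> 'e \<Rightarrow> 'a) \<Rightarrow> ('e \<Rightarrow> 'e) \<Rightarrow> bool" where
  "adjointable ip T \<longleftrightarrow> (\<exists>T'. is_adjoint ip T T')"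

text \<open>
  A map preserving all the structure of a Hilbert module: a unitary between
  \<open>(V, sc, act, ip)\<close> and \<open>(V', sc', act', ip')\<close>.
\<close>
definition module_unitary ::
  "'v::ab_group_add set \<Rightarrow> (complex \<Rightarrow> 'v \<Rightarrow> 'v) \<Rightarrow> ('v \<Rightarrow> 'a \<Rightarrow> 'v) \<Rightarrow> ('v \<Rightarrow> 'v \<Rightarrow> 'a) \<Rightarrow>
   'w::ab_group_add set \<Rightarrow> (complex \<Rightarrow> 'w \<Rightarrow> 'w) \<Rightarrow> ('w \<Rightarrow> 'a \<Rightarrow> 'w) \<Rightarrow> ('w \<Rightarrow> 'w \<Rightarrow> 'a) \<Rightarrow>
   ('v \<Rightarrow> 'w) \<Rightarrow> bool" where
  "module_unitary V sc act ip V' sc' act' ip' U \<longleftrightarrow>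
     bij_betw U V V' \<and>
     (\<forall>x\<in>V. \<forall>y\<in>V. U (x + y) = U x + U y) \<and>
     (\<forall>x\<in>V. \<forall>c. U (sc c x) = sc' c (U x)) \<and>
     (\<forall>x\<in>V. \<forall>a. U (act x a) = act' (U x) a) \<and>
     (\<forall>x\<in>V. \<forall>y\<in>V. ip' (U x) (U y) = ip x y)"


section \<open>The dual module\<close>

definition dual_module ::
  "('h::complex_vector \<Rightarrow> 'a::cstar_algebra \<Rightarrow> 'h) \<Rightarrow> ('h \<Rightarrow> 'h \<Rightarrow> 'a) \<Rightarrow> ('h \<Rightarrow> 'a) set" where
  "dual_module act ip = {\<tau>. bounded_module_map UNIV scaleC act ip \<tau>}"

definition dual_scale :: "complex \<Rightarrow> ('h \<Rightarrow> 'a::cstar_algebra) \<Rightarrow> ('h \<Rightarrow> 'a)" where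
  "dual_scale c \<tau> = (\<lambda>x. cnj c *\<^sub>C \<tau> x)"

definition dual_act :: "('h \<Rightarrow> 'a::cstar_algebra) \<Rightarrow> 'a \<Rightarrow> ('h \<Rightarrow> 'a)" where
  "dual_act \<tau> a = (\<lambda>x. star a * \<tau> x)"

text \<open>
  The self-dual extension to the dual module of the inner product \<open>ip\<close>; \<open>ip x\<close> is the canonical
  image \<open>\<langle>x, \<cdot>\<rangle>\<close> of \<open>x\<close>. At most one \<open>ip'\<close> has these properties (up to its values outside the dual
  module), and over a \<open>W\<^sup>*\<close>-algebra one exists, by Paschke's theorem.
\<close>
definition dual_inner_product ::
  "('h::complex_vector \<Rightarrow> 'a::cstar_algebra \<Rightarrow> 'h) \<Rightarrow> ('h \<Rightarrow> 'h \<Rightarrow> 'a) \<Rightarrow>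
   (('h \<Rightarrow> 'a) \<Rightarrow> ('h \<Rightarrow> 'a) \<Rightarrow> 'a) \<Rightarrow> bool" where
  "dual_inner_product act ip ip' \<longleftrightarrow>
     hilbert_module (dual_module act ip) dual_scale dual_act ip' \<and>
     (\<forall>x y. ip' (ip x) (ip y) = ip x y) \<and>
     (\<forall>\<tau>\<in>dual_module act ip. \<forall>x. ip' \<tau> (ip x) = \<tau> x) \<and>
     (\<forall>F. bounded_module_map (dual_module act ip) dual_scale dual_act ip' F \<longrightarrow>
        (\<exists>\<psi>\<in>dual_module act ip. \<forall>\<tau>\<in>dual_module act ip. F \<tau> = ip' \<psi> \<tau>))"


section \<open>Hilbert modules of functions and reproducing kernels\<close>

definition fun_scale :: "complex \<Rightarrow> ('s \<Rightarrow> 'e::complex_vector) \<Rightarrow> ('s \<Rightarrow> 'e)" where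
  "fun_scale c f = (\<lambda>s. c *\<^sub>C f s)"

definition fun_act :: "('e \<Rightarrow> 'a \<Rightarrow> 'e) \<Rightarrow> ('s \<Rightarrow> 'e) \<Rightarrow> 'a \<Rightarrow> ('s \<Rightarrow> 'e)" where
  "fun_act actE f a = (\<lambda>s. actE (f s) a)"

definition function_hilbert_module ::
  "('e::complex_vector \<Rightarrow> 'a::cstar_algebra \<Rightarrow> 'e) \<Rightarrow>
   ('s \<Rightarrow> 'e) set \<Rightarrow> (('s \<Rightarrow> 'e) \<Rightarrow> ('s \<Rightarrow> 'e) \<Rightarrow> 'a) \<Rightarrow> bool" where
  "function_hilbert_module actE M ipM \<longleftrightarrow> hilbert_module M fun_scale (fun_act actE) ipM"

definition relative_reproducing_kernel ::
  "('e::complex_vector \<Rightarrow> 'a::cstar_algebra \<Rightarrow> 'e) \<Rightarrow> ('e \<Rightarrow> 'e \<Rightarrow> 'a) \<Rightarrow>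
   ('s \<Rightarrow> 'e) set \<Rightarrow> (('s \<Rightarrow> 'e) \<Rightarrow> ('s \<Rightarrow> 'e) \<Rightarrow> 'a) \<Rightarrow>
   ('e \<Rightarrow> 's \<Rightarrow> 's \<Rightarrow> ('s \<Rightarrow> 'e)) \<Rightarrow> bool" where
  "relative_reproducing_kernel actE ipE M ipM D \<longleftrightarrow>
     function_hilbert_module actE M ipM \<and>
     (\<forall>x s t. D x s t \<in> M) \<and>
     (\<forall>f\<in>M. \<forall>x s t. ipE (f s - f t) x = ipM f (D x s t))"

definition positive_definite_kernel ::
  "('e::complex_vector \<Rightarrow> 'e \<Rightarrow> 'a::cstar_algebra) \<Rightarrow> ('s \<Rightarrow> 's \<Rightarrow> 'e \<Rightarrow> 'e) \<Rightarrow> bool" where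
  "positive_definite_kernel ipE K \<longleftrightarrow>
     (\<forall>s t. adjointable ipE (K s t)) \<and>
     (\<forall>s t. is_adjoint ipE (K s t) (K t s)) \<and>
     (\<forall>n\<ge>2. \<forall>(s::nat \<Rightarrow> 's) (x::nat \<Rightarrow> 'e).
        positive (\<Sum>i=1..n. \<Sum>j=1..n. ipE (K (s i) (s j) (x i)) (x j)))"

definition kernel_section :: "('s \<Rightarrow> 's \<Rightarrow> 'e \<Rightarrow> 'e) \<Rightarrow> 'e \<Rightarrow> 's \<Rightarrow> ('s \<Rightarrow> 'e)" where
  "kernel_section K x s = (\<lambda>t. K s t x)"

text \<open>
  The weak\<open>\<^sup>*\<close> topology of a Hilbert \<open>W\<^sup>*\<close>-module \<open>M\<close>: the initial topology of the functionals
  \<open>f \<mapsto> \<phi> \<langle>g, f\<rangle>\<close> with \<open>g \<in> M\<close> and \<open>\<phi>\<close> in the predual \<open>P\<close> of the algebra.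
\<close>
definition weak_star_topology ::
  "('a::cstar_algebra \<Rightarrow>\<^sub>L complex) set \<Rightarrow> 'v set \<Rightarrow> ('v \<Rightarrow> 'v \<Rightarrow> 'a) \<Rightarrow> 'v topology" where
  "weak_star_topology P M ip =
     topology_generated_by
       {{f \<in> M. blinfun_apply \<phi> (ip g f) \<in> W} | g \<phi> W. g \<in> M \<and> \<phi> \<in> P \<and> open W}"

text \<open>
  Over a \<open>W\<^sup>*\<close>-algebra, density of the span of the functions \<open>K\<^bsub>x,s\<^esub>\<close> is density in the weak\<open>\<^sup>*\<close>
  topology. (For Hilbert spaces this is the same as norm density.) Norm density is too much to ask
  of a self-dual module: let the algebra be \<open>\<ell>\<^sup>\<infinity>\<close>, let \<open>E = c\<^sub>0\<close> and let \<open>M\<close> be the self-dual module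
  \<open>\<ell>\<^sup>\<infinity>\<close>, with \<open>f \<in> M\<close> regarded as the function \<open>n \<mapsto> f(n)e\<^sub>n\<close> from the natural numbers to \<open>E\<close>. It has
  the reproducing kernel \<open>K(s,t)x = x(s)e\<^sub>s\<close> if \<open>s = t\<close> and \<open>0\<close> otherwise, but the functions \<open>K\<^bsub>x,s\<^esub>\<close>
  only span the finitely supported sequences.
\<close>
definition reproducing_kernel_module ::
  "('a::cstar_algebra \<Rightarrow>\<^sub>L complex) set \<Rightarrow>
   ('e::complex_vector \<Rightarrow> 'a \<Rightarrow> 'e) \<Rightarrow> ('e \<Rightarrow> 'e \<Rightarrow> 'a) \<Rightarrow>
   ('s \<Rightarrow> 'e) set \<Rightarrow> (('s \<Rightarrow> 'e) \<Rightarrow> ('s \<Rightarrow> 'e) \<Rightarrow> 'a) \<Rightarrow>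
   ('s \<Rightarrow> 's \<Rightarrow> 'e \<Rightarrow> 'e) \<Rightarrow> bool" where
  "reproducing_kernel_module P actE ipE M ipM K \<longleftrightarrow>
     function_hilbert_module actE M ipM \<and>
     positive_definite_kernel ipE K \<and>
     (\<forall>x s. kernel_section K x s \<in> M) \<and>
     weak_star_topology P M ipM closure_of
       (submodule fun_scale (fun_act actE) hull {kernel_section K x s | x s. True}) = M \<and>
     (\<forall>x y s t. ipM (kernel_section K x s) (kernel_section K y t) = ipE (K s t x) y) \<and>
     (\<forall>f\<in>M. \<forall>x s. ipE (f s) x = ipM f (kernel_section K x s))"

end

theory Submission
  imports Defs
begin

text \<open>
  A continuous \<open>\<AA>\<close>-linear map on a self-dual module is bounded and therefore given by an inner product.
  Applied to \<open>f \<mapsto> \<langle>x, f(s\<^sub>0)\<rangle>\<close> this yields \<open>k\<^sub>x\<close> with \<open>\<langle>f(s\<^sub>0), x\<rangle> = \<langle>f, k\<^sub>x\<rangle>\<close>, and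
  adding the relation that defines the relative kernel gives
  \<open>\<langle>f(s), x\<rangle> = \<langle>f, D\<^bsub>x,s,s\<^sub>0\<^esub> + k\<^sub>x\<rangle>\<close>. So the sections of the kernel have to be
  \<open>K\<^bsub>x,s\<^esub> = D\<^bsub>x,s,s\<^sub>0\<^esub> + k\<^sub>x\<close>. Hermitian symmetry, positivity and the formula for \<open>D\<close> are formal
  consequences of the reproducing property, and the same property shows that only \<open>0\<close> is orthogonal
  to all the \<open>K\<^bsub>x,s\<^esub>\<close>.

  The analytic part is the density of their span \<open>N\<close>: in a self-dual module over a \<open>W\<^sup>*\<close>-algebra a
  submodule with zero orthogonal complement is weak\<open>\<^sup>*\<close> dense
  (\<open>weak_closure_eq_of_orthogonal_zero\<close>). The identity is obtained as \<open>1 - T\<close> with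
  \<open>T = 0\<close>, where \<open>T\<close> is a minimal element among the operators \<open>0 \<le> T \<le> 1\<close> such that \<open>1 - T\<close> maps
  into the weak\<open>\<^sup>*\<close> closure of \<open>N\<close>. A minimal element exists by Zorn's lemma, since every chain of
  such operators has an infimum, which is also a weak\<open>\<^sup>*\<close> limit (\<open>effect_chain_infimum\<close>). If some
  \<open>n \<in> N\<close> were not orthogonal to the range of \<open>T\<close>, the operator
  \<open>T (1 - c n\<langle>n, \<cdot>\<rangle>) T\<close> would be strictly smaller; so the range of \<open>T\<close> lies in the orthogonal
  complement of \<open>N\<close>, which is zero.

  The usual proof that the limit of a chain is \<open>\<AA>\<close>-linear would quote Sakai's theorem that
  multiplication in a \<open>W\<^sup>*\<close>-algebra is separately weak\<open>\<^sup>*\<close> continuous. Here the limits are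
  monotone, and it is enough that they are infima in the order of the algebra, because conjugation by
  an invertible element preserves the order. What is needed about the predual is then only that
  bounded sets are weak\<open>\<^sup>*\<close> relatively compact (\<open>weak_star_convergent_refinement\<close>) and that
  positivity survives bounded weak\<open>\<^sup>*\<close> limits (\<open>nonneg_weak_star_lim\<close>).

  Positivity is expressed through norms rather than spectra: a self-adjoint \<open>a\<close> is nonnegative if
  \<open>norm (t - a) \<le> t\<close> for some real \<open>t\<close>. The elements \<open>b\<^sup>*b\<close> are nonnegative in this sense
  (\<open>nonneg_star_mult\<close>), and the cone of nonnegative elements is visibly closed under addition and
  stable under norm limits. Square roots come from an explicit iteration
  (\<open>sqrt_one_minus_exists\<close>), and commuting square roots combine to unitaries, which supplies all the
  norm estimates that are otherwise read off from the spectrum (\<open>norm_le_of_sum_of_squares\<close>).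
\<close>

section \<open>Self-adjoint elements\<close>

lemma scaleC_zero_right [simp]: "c *\<^sub>C (0::'a::complex_vector) = 0"
  using scaleC_add_right[of c "0::'a" 0] by simp

lemma scaleC_zero_left [simp]: "0 *\<^sub>C (x::'a::complex_vector) = 0"
  using scaleC_add_left[of 0 0 x] by simp

lemma scaleC_minus_right: "c *\<^sub>C (- x) = - (c *\<^sub>C (x::'a::complex_vector))"
  using scaleC_add_right[of c x "- x"] by (simp add: eq_neg_iff_add_eq_0 add.commute)

lemma scaleC_minus_left: "(- c) *\<^sub>C x = - (c *\<^sub>C (x::'a::complex_vector))"
  using scaleC_add_left[of c "- c" x] by (simp add: eq_neg_iff_add_eq_0 add.commute)

lemma scaleC_diff_right: "c *\<^sub>C (x - y) = c *\<^sub>C x - c *\<^sub>C (y::'a::complex_vector)"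
  using scaleC_add_right[of c x "- y"] by (simp add: scaleC_minus_right)

lemmas scaleC_mult = scaleC_mult_left scaleC_mult_right

lemma star_zero [simp]: "star (0::'a::cstar_algebra) = 0"
  using star_add[of "0::'a" 0] by simp

lemma star_minus: "star (- a) = - star (a::'a::cstar_algebra)"
  using star_add[of a "- a"] by (simp add: eq_neg_iff_add_eq_0 add.commute)

lemma star_diff: "star (a - b) = star a - star (b::'a::cstar_algebra)"
  using star_add[of a "- b"] by (simp add: star_minus)

lemma star_scaleR: "star (r *\<^sub>R a) = r *\<^sub>R star (a::'a::cstar_algebra)"
  by (simp add: scaleR_scaleC star_scaleC)

lemmas star_simps = star_zero star_add star_minus star_diff star_mult star_scaleC star_scaleR star_star

lemma norm_star [simp]: "norm (star a) = norm (a::'a::cstar_algebra)"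
proof -
  have le: "norm b \<le> norm (star b)" for b :: 'a
  proof (cases "b = 0")
    case False
    have "norm b * norm b \<le> norm (star b) * norm b"
      using norm_mult_ineq[of "star b" b] by (simp add: cstar_identity power2_eq_square)
    then show ?thesis using False by simp
  qed simp
  show ?thesis using le[of a] le[of "star a"] by (simp add: star_star)
qed

lemma norm_selfadjoint_square: "star a = a \<Longrightarrow> norm (a * a) = (norm (a::'a::cstar_algebra))\<^sup>2"
  using cstar_identity[of a] by simp

lemma tendsto_star:
  "(f \<longlongrightarrow> l) F \<Longrightarrow> ((\<lambda>x. star (f x)) \<longlongrightarrow> star (l::'a::cstar_algebra)) F"
proof -
  assume f: "(f \<longlongrightarrow> l) F"
  have "bounded_linear (star :: 'a \<Rightarrow> 'a)"
    by (rule bounded_linear_intro[where K=1]) (simp_all add: star_simps)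
  from bounded_linear.tendsto[OF this f] show ?thesis .
qed

text \<open>
  The iteration \<open>v \<mapsto> (w + v\<^sup>2)/2\<close> started at \<open>0\<close> consists of polynomials in \<open>w\<close> with nonnegative
  coefficients. For \<open>norm w \<le> 1\<close> it is therefore dominated by the scalar iteration
  \<open>u \<mapsto> (1 + u\<^sup>2)/2\<close>, which increases and is bounded by \<open>1\<close>; this gives convergence up to and
  including \<open>norm w = 1\<close>. In the presence of a unit the limit \<open>v\<close> satisfies \<open>(1 - v)\<^sup>2 = 1 - w\<close>.
\<close>
lemma sqrt_one_minus_exists:
  fixes w :: "'a::cstar_algebra"
  assumes sa: "star w = w" and w1: "norm w \<le> 1"
  obtains v where "star v = v" "norm v \<le> 1" "v + v = w + v * v"
    "\<And>c. c * w = w * c \<Longrightarrow> c * v = v * c"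
proof -
  define v where "v = rec_nat 0 (\<lambda>_ x. (1/2) *\<^sub>R (w + x * x))"
  define u where "u = rec_nat 0 (\<lambda>_ x. (1 + x * x) / (2::real))"
  have v0: "v 0 = 0" and vS: "v (Suc n) = (1/2) *\<^sub>R (w + v n * v n)" for n
    by (simp_all add: v_def)
  have u0: "u 0 = 0" and uS: "u (Suc n) = (1 + u n * u n) / 2" for n
    by (simp_all add: u_def)
  have u_nonneg: "0 \<le> u n" and u_le: "u n \<le> 1" for n
  proof (induction n)
    case (Suc n) 
    { case 1 show ?case unfolding uS by simp } 
    { case 2 have "u n * u n \<le> 1 * 1" using Suc by (intro mult_mono) auto
      then show ?case using uS[of n] by simp }
  qed (auto simp: u0)
  have vu: "norm (v n) \<le> u n" for n
  proof (induction n)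
    case (Suc n)
    have "norm (v n * v n) \<le> u n * u n"
      using norm_mult_ineq[of "v n" "v n"] mult_mono[OF Suc Suc] u_nonneg[of n] by simp
    then have "norm (w + v n * v n) \<le> 1 + u n * u n"
      using norm_triangle_ineq[of w "v n * v n"] w1 by linarith
    then show ?case by (simp add: vS uS)
  qed (simp add: v0 u0)
  have step: "norm (v (Suc n) - v n) \<le> u (Suc n) - u n" for n
  proof (induction n)
    case (Suc n)
    let ?d = "v (Suc n) - v n"
    have "v (Suc (Suc n)) - v (Suc n) = (1/2) *\<^sub>R (v (Suc n) * v (Suc n) - v n * v n)"
      unfolding vS[of "Suc n"] vS[of n] by (simp add: scaleR_diff_right[symmetric])
    also have "v (Suc n) * v (Suc n) - v n * v n = v (Suc n) * ?d + ?d * v n"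
      by (simp add: algebra_simps)
    finally have eq: "v (Suc (Suc n)) - v (Suc n) = (1/2) *\<^sub>R (v (Suc n) * ?d + ?d * v n)" .
    have "norm (v (Suc n) * ?d + ?d * v n) \<le> norm (v (Suc n)) * norm ?d + norm ?d * norm (v n)"
      by (meson add_mono norm_mult_ineq norm_triangle_le)
    also have "\<dots> \<le> u (Suc n) * (u (Suc n) - u n) + (u (Suc n) - u n) * u n"
      using Suc order_trans[OF norm_ge_zero Suc] vu[of n] vu[of "Suc n"] u_nonneg[of n] u_nonneg[of "Suc n"]
      by (intro add_mono mult_mono) auto
    also have "\<dots> = 2 * (u (Suc (Suc n)) - u (Suc n))"
      unfolding uS[of "Suc n"] uS[of n] by (simp add: field_simps)
    finally show ?case unfolding eq by simp
  qed (simp add: v0 u0 vS uS w1)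
  have "incseq u"
    using step by (intro incseq_SucI) (smt (verit) norm_ge_zero)
  then obtain ul where "u \<longlonglongrightarrow> ul"
    using incseq_convergent[of u 1] u_le by blast
  then have "summable (\<lambda>n. u (Suc n) - u n)" by (rule telescope_summable)
  then have "summable (\<lambda>n. v (Suc n) - v n)"
    by (rule summable_comparison_test[rotated]) (use step in auto)
  then have "(\<lambda>n. \<Sum>k<n. v (Suc k) - v k) \<longlonglongrightarrow> (\<Sum>n. v (Suc n) - v n)"
    by (rule summable_LIMSEQ)
  then obtain l where l: "v \<longlonglongrightarrow> l" by (simp add: sum_lessThan_telescope v0)
  have star_v: "star (v n) = v n" for n
    by (induction n) (simp_all add: v0 vS star_simps sa)
  have comm_v: "c * v n = v n * c" if "c * w = w * c" for c n
  proof (induction n)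
    case (Suc n)
    have "c * (v n * v n) = v n * v n * c" by (metis Suc mult.assoc)
    then show ?case by (simp add: vS that algebra_simps)
  qed (simp add: v0)
  show ?thesis
  proof (rule that[of l])
    show "star l = l"
      using LIMSEQ_unique[OF tendsto_star[OF l]] l by (simp add: star_v)
    show "norm l \<le> 1"
      using vu u_le by (intro LIMSEQ_le_const2[OF tendsto_norm[OF l]]) (meson order_trans)
    have "(\<lambda>n. v (Suc n)) \<longlonglongrightarrow> (1/2) *\<^sub>R (w + l * l)"
      unfolding vS by (intro tendsto_intros l)
    then have "l = (1/2) *\<^sub>R (w + l * l)"
      using LIMSEQ_Suc[OF l] LIMSEQ_unique by blast
    then have "2 *\<^sub>R l = w + l * l" by (metis scaleR_half_double scaleR_2 scaleR_add_right)
    then show "l + l = w + l * l" by (simp add: scaleR_2)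
    show "c * l = l * c" if "c * w = w * c" for c
    proof -
      have "(\<lambda>n. c * v n) \<longlonglongrightarrow> c * l" "(\<lambda>n. v n * c) \<longlonglongrightarrow> l * c"
        by (intro tendsto_intros l)+
      then show ?thesis using comm_v[OF that] LIMSEQ_unique by simp
    qed
  qed
qed


section \<open>The order of a unital \<open>C\<^sup>*\<close>-algebra\<close>

locale unital_cstar_algebra =
  fixes e :: "'a::cstar_algebra"
  assumes unit_left: "e * a = a" and unit_right: "a * e = a"
begin

lemmas unit_simps [simp] = unit_left unit_right

lemma star_unit [simp]: "star e = e"
  by (metis star_mult star_star unit_left unit_right)

lemma norm_unit_le: "norm e \<le> 1"
proof -
  have "norm e = (norm e)\<^sup>2" using cstar_identity[of e] by simp
  then have "norm e * (norm e - 1) = 0" by (simp add: power2_eq_square algebra_simps)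
  then show ?thesis by auto
qed

lemma norm_scaleR_unit_le: "norm (r *\<^sub>R e) \<le> \<bar>r\<bar>"
  using norm_unit_le mult_left_le by fastforce

text \<open>
  For self-adjoint \<open>a\<close> the inequality \<open>norm (t - a) \<le> t\<close> says that the spectrum lies in
  \<open>[0, 2t]\<close>. This form of positivity makes sums and limits easy and needs no spectral theory; that
  it agrees with \<^const>\<open>positive\<close> in the direction used below is \<open>positive_imp_nonneg\<close>.
\<close>
definition nonneg :: "'a \<Rightarrow> bool" where
  "nonneg a \<longleftrightarrow> star a = a \<and> (\<exists>t. norm (t *\<^sub>R e - a) \<le> t)"

lemma nonneg_selfadjoint: "nonneg a \<Longrightarrow> star a = a"
  by (simp add: nonneg_def)

lemma nonneg_zero [simp]: "nonneg 0"
  by (auto simp: nonneg_def intro: exI[of _ 0])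

lemma nonneg_add: assumes "nonneg a" "nonneg b" shows "nonneg (a + b)"
proof -
  obtain s t where "norm (s *\<^sub>R e - a) \<le> s" "norm (t *\<^sub>R e - b) \<le> t"
    using assms by (auto simp: nonneg_def)
  then have "norm ((s + t) *\<^sub>R e - (a + b)) \<le> s + t"
    using norm_triangle_ineq[of "s *\<^sub>R e - a" "t *\<^sub>R e - b"] by (simp add: algebra_simps)
  then show ?thesis using assms by (auto simp: nonneg_def star_simps)
qed

lemma nonneg_scaleR: assumes "nonneg a" "0 \<le> r" shows "nonneg (r *\<^sub>R a)"
proof -
  obtain t where "norm (t *\<^sub>R e - a) \<le> t" using assms by (auto simp: nonneg_def)
  moreover have "(r * t) *\<^sub>R e - r *\<^sub>R a = r *\<^sub>R (t *\<^sub>R e - a)" by (simp add: algebra_simps)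
  ultimately have "norm ((r * t) *\<^sub>R e - r *\<^sub>R a) \<le> r * t" using assms(2) by (simp add: mult_left_mono)
  then show ?thesis using assms by (auto simp: nonneg_def star_simps)
qed

lemma nonneg_norm_minus: "star a = a \<Longrightarrow> norm a \<le> r \<Longrightarrow> nonneg (r *\<^sub>R e - a)"
  by (auto simp: nonneg_def star_simps intro!: exI[of _ r])

text \<open>
  If \<open>s\<close> and \<open>y\<close> commute and \<open>s\<^sup>2 + y\<^sup>2 = r\<close>, then \<open>y + is\<close> is \<open>\<surd>r\<close> times a unitary, and \<open>s\<close> is its
  imaginary part. This replaces every appeal to the spectrum.
\<close>
lemma norm_le_of_sum_of_squares:
  assumes "star s = s" "star y = y" "s * y = y * s" "s * s + y * y = r *\<^sub>R e" "0 \<le> r"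
  shows "(norm s)\<^sup>2 \<le> r"
proof -
  let ?u = "y + \<i> *\<^sub>C s"
  have su: "star ?u = y - \<i> *\<^sub>C s"
    using assms by (simp add: star_simps scaleC_minus_left)
  have "star ?u * ?u = y * y + \<i> *\<^sub>C (y * s) - \<i> *\<^sub>C (s * y) - \<i> *\<^sub>C \<i> *\<^sub>C (s * s)"
    unfolding su by (simp add: algebra_simps scaleC_mult scaleC_add_right scaleC_diff_right)
  also have "\<dots> = r *\<^sub>R e"
    using assms by (simp add: scaleC_scaleC scaleC_minus_left scaleC_one algebra_simps)
  finally have "(norm ?u)\<^sup>2 \<le> r"
    using cstar_identity[of ?u] norm_scaleR_unit_le[of r] assms(5) by simp
  moreover have "2 * norm s \<le> 2 * norm ?u"
  proof -
    have "?u - star ?u = (2 * \<i>) *\<^sub>C s"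
      unfolding su using scaleC_add_left[of \<i> \<i> s] by simp
    then have "2 * norm s = norm (?u - star ?u)" by (simp add: norm_scaleC norm_mult)
    also have "\<dots> \<le> 2 * norm ?u" using norm_triangle_ineq4[of ?u "star ?u"] by simp
    finally show ?thesis .
  qed
  ultimately show ?thesis by (smt (verit) norm_ge_zero power_mono)
qed

lemma norm_unit_minus_square_le:
  assumes "star y = y" "norm y \<le> 1"
  shows "norm (e - y * y) \<le> 1"
proof -
  have "norm (y * y) \<le> 1" using assms norm_selfadjoint_square[of y] by (simp add: power_le_one)
  then obtain v where v: "star v = v" "v + v = y * y + v * v"
      "\<And>c. c * (y * y) = (y * y) * c \<Longrightarrow> c * v = v * c"
    using sqrt_one_minus_exists[of "y * y"] assms(1) by (metis star_mult)
  let ?s = "e - v"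
  have "?s * ?s = e - (v + v) + v * v" by (simp add: algebra_simps)
  then have sq: "?s * ?s = e - y * y" unfolding v(2) by simp
  have "(norm ?s)\<^sup>2 \<le> 1"
  proof (rule norm_le_of_sum_of_squares)
    show "?s * y = y * ?s" using v(3)[of y] by (simp add: algebra_simps)
    show "star ?s = ?s" by (simp add: star_simps v(1))
    show "?s * ?s + y * y = 1 *\<^sub>R e" by (simp add: sq)
  qed (simp_all add: assms)
  moreover have "norm (?s * ?s) = (norm ?s)\<^sup>2" 
    by (rule norm_selfadjoint_square) (simp add: star_simps v(1))
  ultimately show ?thesis using sq by simp
qed

lemma norm_minus_square_le:
  assumes sa: "star y = y" and r: "(norm y)\<^sup>2 \<le> r"
  shows "norm (r *\<^sub>R e - y * y) \<le> r"
proof (cases "r = 0")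
  case True
  then show ?thesis using r by simp
next
  case False
  then have r0: "0 < r" using r by (smt (verit) zero_le_power2)
  let ?z = "(1 / sqrt r) *\<^sub>R y"
  have "norm ?z \<le> 1"
    using r r0 real_le_rsqrt[of "norm y" r] by (simp add: field_simps)
  then have 1: "norm (e - ?z * ?z) \<le> 1"
    using norm_unit_minus_square_le[of ?z] sa by (simp add: star_simps)
  have "?z * ?z = (1 / r) *\<^sub>R (y * y)" using r0 by (simp add: divide_simps)
  then have "r *\<^sub>R e - y * y = r *\<^sub>R (e - ?z * ?z)" using r0 by (simp add: algebra_simps)
  then show ?thesis using 1 r0 by simp
qed

lemma nonneg_square: "star y = y \<Longrightarrow> nonneg (y * y)"
  using norm_minus_square_le[of y "(norm y)\<^sup>2"] by (auto simp: nonneg_def star_simps)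

lemma nonneg_sqrt_exists:
  assumes "nonneg x"
  obtains s where "nonneg s" "s * s = x" "\<And>c. c * x = x * c \<Longrightarrow> c * s = s * c"
proof -
  obtain t0 where t0: "norm (t0 *\<^sub>R e - x) \<le> t0" and sa: "star x = x"
    using assms by (auto simp: nonneg_def)
  define t where "t = t0 + 1"
  have t: "0 < t" using t0 norm_ge_zero[of "t0 *\<^sub>R e - x"] unfolding t_def by linarith
  have "t *\<^sub>R e - x = (t0 *\<^sub>R e - x) + e" unfolding t_def by (simp add: algebra_simps)
  also have "norm \<dots> \<le> t"
    using norm_triangle_ineq[of "t0 *\<^sub>R e - x" e] t0 norm_unit_le unfolding t_def by linarith
  finally have tx: "norm (t *\<^sub>R e - x) \<le> t" .
  define w where "w = e - (1 / t) *\<^sub>R x"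
  have "w = (1 / t) *\<^sub>R (t *\<^sub>R e - x)" using t by (simp add: w_def algebra_simps)
  then have "norm w \<le> 1" using tx t by simp
  moreover have "star w = w" using sa by (simp add: w_def star_simps)
  ultimately obtain v where v: "star v = v" "norm v \<le> 1" "v + v = w + v * v"
      "\<And>c. c * w = w * c \<Longrightarrow> c * v = v * c"
    using sqrt_one_minus_exists by blast
  have "(e - v) * (e - v) = e - (v + v) + v * v" by (simp add: algebra_simps)
  also have "\<dots> = e - w" unfolding v(3) by simp
  also have "\<dots> = (1 / t) *\<^sub>R x" by (simp add: w_def)
  finally have sq: "(sqrt t *\<^sub>R (e - v)) * (sqrt t *\<^sub>R (e - v)) = x"
    using t by simp
  show ?thesis
  proof (rule that[OF _ sq])
    have "norm (sqrt t *\<^sub>R e - sqrt t *\<^sub>R (e - v)) \<le> sqrt t"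
      using v(2) t by (simp add: scaleR_diff_right mult_left_le)
    then show "nonneg (sqrt t *\<^sub>R (e - v))"
      unfolding nonneg_def by (auto simp: star_simps v(1))
    show "c * (sqrt t *\<^sub>R (e - v)) = sqrt t *\<^sub>R (e - v) * c" if "c * x = x * c" for c
      using v(4)[of c] that by (simp add: w_def algebra_simps)
  qed
qed

text \<open>
  The witness \<open>t\<close> in the definition of \<^const>\<open>nonneg\<close> may be any bound of the norm. So nonnegativity
  is a single norm inequality on each bounded set, which is what makes it pass to weak\<open>\<^sup>*\<close> limits.
\<close>
lemma norm_minus_nonneg_le:
  assumes "nonneg x" "norm x \<le> r"
  shows "norm (r *\<^sub>R e - x) \<le> r"
proof -
  obtain s where s: "nonneg s" "s * s = x" using assms(1) nonneg_sqrt_exists by blast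
  then show ?thesis
    using norm_minus_square_le[of s r] norm_selfadjoint_square[of s] assms(2) nonneg_selfadjoint[of s] by simp
qed

lemma norm_le_of_nonneg_minus:
  assumes "nonneg x" "nonneg (r *\<^sub>R e - x)" "0 \<le> r"
  shows "norm x \<le> r"
proof -
  obtain s where s: "nonneg s" "s * s = x" "\<And>c. c * x = x * c \<Longrightarrow> c * s = s * c"
    using assms(1) nonneg_sqrt_exists by blast
  obtain z where z: "nonneg z" "z * z = r *\<^sub>R e - x"
      "\<And>c. c * (r *\<^sub>R e - x) = (r *\<^sub>R e - x) * c \<Longrightarrow> c * z = z * c"
    using assms(2) nonneg_sqrt_exists by blast
  have "s * x = x * s" using s(2) by (metis mult.assoc)
  then have "s * z = z * s" by (intro z(3)) (simp add: algebra_simps)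
  moreover have "s * s + z * z = r *\<^sub>R e" by (simp add: s(2) z(2))
  ultimately have "(norm s)\<^sup>2 \<le> r"
    using nonneg_selfadjoint[OF s(1)] nonneg_selfadjoint[OF z(1)] assms(3)
    by (intro norm_le_of_sum_of_squares)
  moreover have "norm x = (norm s)\<^sup>2"
    using norm_selfadjoint_square[OF nonneg_selfadjoint[OF s(1)]] by (simp add: s(2))
  ultimately show ?thesis by simp
qed

lemma nonneg_antisym: assumes "nonneg x" "nonneg (- x)" shows "x = 0"
  using norm_le_of_nonneg_minus[of x 0] assms by simp

lemma norm_mono: 
  assumes "nonneg x" "nonneg (y - x)"
  shows "norm x \<le> norm y"
proof (rule norm_le_of_nonneg_minus[OF assms(1)])
  have "star y = y" using nonneg_add[OF assms] by (simp add: nonneg_selfadjoint)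
  then have "nonneg ((norm y *\<^sub>R e - y) + (y - x))"
    by (intro nonneg_add assms nonneg_norm_minus) auto
  then show "nonneg (norm y *\<^sub>R e - x)" by simp
qed simp

text \<open>
  The elements \<open>star c * c\<close> and \<open>c * star c\<close> have the same spectrum up to \<open>0\<close>; the inequality below
  carries over the upper bound \<open>0\<close> of the spectrum. Since \<open>(1 + c c\<^sup>*)\<^sup>n = 1 + c y c\<^sup>*\<close> where
  \<open>(1 + c\<^sup>*c)\<^sup>n = 1 + c\<^sup>*c y\<close> and \<open>norm y \<le> n\<close>, the powers of \<open>1 + c c\<^sup>*\<close> grow at most linearly. But
  the norm of a self-adjoint element is multiplicative under squaring, so linear growth along
  \<open>n = 2\<^sup>k\<close> forces the norm to be at most \<open>1\<close>.
\<close>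
lemma norm_unit_plus_swap:
  assumes "norm (e + star c * c) \<le> 1"
  shows "norm (e + c * star c) \<le> 1"
proof (rule ccontr)
  let ?Y = "star c * c"
  define y where "y = rec_nat e (\<lambda>_ x. x + x + x * ?Y * x)"
  have y0: "y 0 = e" and yS: "y (Suc n) = y n + y n + y n * ?Y * y n" for n
    by (simp_all add: y_def)
  define a where "a n = e + c * y n * star c" for n
  define b where "b n = e + ?Y * y n" for n
  have star_y: "star (y n) = y n" for n
    by (induction n) (simp_all add: y0 yS star_simps mult.assoc)
  have aS: "a (Suc n) = a n * a n" for n
    unfolding a_def yS by (simp add: algebra_simps mult.assoc)
  have bS: "b (Suc n) = b n * b n" for n
    unfolding b_def yS by (simp add: algebra_simps mult.assoc)
  have b1: "norm (b n) \<le> 1" for n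
  proof (induction n)
    case (Suc n)
    then show ?case unfolding bS using norm_mult_ineq[of "b n" "b n"]
      by (smt (verit) mult_le_one norm_ge_zero)
  qed (use assms in \<open>simp add: b_def y0\<close>)
  have y_le: "norm (y n) \<le> 2 ^ n" for n
  proof (induction n)
    case (Suc n)
    have "y (Suc n) = y n + y n * b n" unfolding yS b_def by (simp add: algebra_simps mult.assoc)
    then have "norm (y (Suc n)) \<le> norm (y n) + norm (y n) * norm (b n)"
      by (metis add_left_mono norm_mult_ineq norm_triangle_le)
    also have "\<dots> \<le> 2 ^ n + 2 ^ n * 1"
      using Suc b1[of n] by (intro add_mono mult_mono) auto
    finally show ?case by simp
  qed (use norm_unit_le in \<open>simp add: y0\<close>)
  have a_pow: "norm (a n) = norm (a 0) ^ (2 ^ n)" for n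
  proof (induction n)
    case (Suc n)
    have "star (a n) = a n" by (simp add: a_def star_simps star_y mult.assoc)
    then have "norm (a (Suc n)) = (norm (a n))\<^sup>2" by (simp add: aS norm_selfadjoint_square)
    then show ?case using Suc by (simp add: power_mult[symmetric] mult.commute)
  qed simp
  have a_le: "norm (a n) \<le> 1 + 2 ^ n * (norm c)\<^sup>2" for n
  proof -
    have "norm (c * y n * star c) \<le> norm (c * y n) * norm c"
      using norm_mult_ineq[of "c * y n" "star c"] by simp
    also have "\<dots> \<le> (norm c * norm (y n)) * norm c"
      by (intro mult_right_mono norm_mult_ineq) simp
    also have "\<dots> \<le> (norm c * 2 ^ n) * norm c"
      by (intro mult_right_mono mult_left_mono y_le) auto
    finally have "norm (c * y n * star c) \<le> 2 ^ n * (norm c)\<^sup>2"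
      by (simp add: power2_eq_square mult_ac)
    then show ?thesis
      unfolding a_def using norm_triangle_ineq[of e "c * y n * star c"] norm_unit_le by linarith
  qed
  assume "\<not> norm (e + c * star c) \<le> 1"
  then obtain d where d: "norm (a 0) = 1 + d" "0 < d"
    using that[of "norm (a 0) - 1"] by (simp add: a_def y0)
  let ?C = "1 + 2 * (norm c)\<^sup>2"
  have bound: "2 ^ n * d\<^sup>2 \<le> ?C" for n :: nat
  proof -
    let ?N = "2 ^ n :: real"
    have N1: "1 \<le> ?N" by simp
    have "1 + ?N * d \<le> (1 + d) ^ (2 ^ n)"
      using Bernoulli_inequality[of d "2 ^ n"] d(2) by simp
    then have "?N * d \<le> (1 + d) ^ (2 ^ n)" by simp
    then have "(?N * d)\<^sup>2 \<le> ((1 + d) ^ (2 ^ n))\<^sup>2"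
      using d(2) by (intro power_mono) auto
    also have "\<dots> = norm (a (Suc n))"
      using a_pow[of "Suc n"] d(1) by (simp add: power_mult[symmetric] mult.commute)
    also have "\<dots> \<le> 1 + 2 * ?N * (norm c)\<^sup>2" using a_le[of "Suc n"] by simp
    also have "\<dots> \<le> ?N * ?C" using N1 by (simp add: algebra_simps)
    finally have "?N * (?N * d\<^sup>2) \<le> ?N * ?C" by (simp add: power2_eq_square mult_ac)
    then show ?thesis by (simp add: mult_le_cancel_left_pos)
  qed
  obtain n where "?C / d\<^sup>2 < 2 ^ n" using real_arch_pow[of 2 "?C / d\<^sup>2"] by auto
  then have "?C < 2 ^ n * d\<^sup>2" using d(2) by (simp add: divide_simps)
  then show False using bound[of n] by simp
qed

text \<open>
  If \<open>c\<^sup>*c \<le> 0\<close>, then also \<open>c c\<^sup>* \<le> 0\<close>. But \<open>c\<^sup>*c + c c\<^sup>*\<close> is half the sum of the squares of the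
  self-adjoint elements \<open>c + c\<^sup>*\<close> and \<open>i(c - c\<^sup>*)\<close>, so it is nonnegative and everything vanishes.
\<close>
lemma eq_zero_of_nonneg_minus_star_mult:
  assumes "nonneg (- (star c * c))"
  shows "c = 0"
proof -
  \<comment> \<open>Scaling to norm at most \<open>1\<close> makes \<open>t = 1\<close> a witness for the nonnegativity of \<open>- k\<^sup>*k\<close>.\<close>
  define r where "r = 1 / (norm c + 1)"
  define k where "k = r *\<^sub>R c"
  have r: "0 < r" by (simp add: r_def add_nonneg_pos)
  have kk: "star k * k = (r * r) *\<^sub>R (star c * c)" by (simp add: k_def star_simps)
  then have neg: "nonneg (- (star k * k))"
    using nonneg_scaleR[OF assms, of "r * r"] by simp
  have "norm k = norm c / (norm c + 1)" by (simp add: k_def r_def)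
  also have "\<dots> \<le> 1" by (rule divide_le_eq_1_pos[THEN iffD2]) (simp_all add: add_nonneg_pos)
  finally have "norm k \<le> 1" .
  then have "norm (- (star k * k)) \<le> 1" by (simp add: cstar_identity power_le_one)
  then have "norm (e + star k * k) \<le> 1" using norm_minus_nonneg_le[OF neg, of 1] by simp
  then have "norm (e + k * star k) \<le> 1" by (rule norm_unit_plus_swap)
  then have neg': "nonneg (- (k * star k))"
    unfolding nonneg_def by (auto simp: star_simps intro!: exI[of _ 1])
  let ?p = "k + star k" and ?q = "\<i> *\<^sub>C (k - star k)"
  have "nonneg (?p * ?p)" "nonneg (?q * ?q)"
    by (intro nonneg_square;
        simp add: star_simps scaleC_minus_left scaleC_diff_right algebra_simps)+
  then have "nonneg ((1/2) *\<^sub>R (?p * ?p + ?q * ?q) + - (k * star k))"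
    by (intro nonneg_add nonneg_scaleR neg') auto
  moreover have "?p * ?p + ?q * ?q = 2 *\<^sub>R (star k * k + k * star k)"
    by (simp add: scaleC_mult scaleC_diff_right scaleC_scaleC scaleC_minus_left scaleC_one
        algebra_simps scaleR_2)
  ultimately have "nonneg (star k * k)" by simp
  then have "star k * k = 0" using neg nonneg_antisym by blast
  then have "k = 0" using cstar_identity[of k] by simp
  then show ?thesis using r by (simp add: k_def)
qed

text \<open>
  With \<open>x = star b * b\<close>, \<open>s = \<bar>x\<bar>\<close> and \<open>m = s - x\<close> (twice the negative part of \<open>x\<close>), the relation
  \<open>s\<^sup>2 = x\<^sup>2\<close> gives \<open>m x m = - m s m = - (\<surd>s m)\<^sup>2\<close>, so \<open>c = b m\<close> has \<open>star c * c \<le> 0\<close> and must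
  vanish. Then \<open>x m = 0\<close>, which forces \<open>m = 0\<close> and \<open>x = s\<close>.
\<close>
lemma nonneg_star_mult: "nonneg (star b * b)"
proof -
  define x where "x = star b * b"
  have sax: "star x = x" by (simp add: x_def star_simps)
  obtain s where s: "nonneg s" "s * s = x * x" "\<And>c. c * (x * x) = (x * x) * c \<Longrightarrow> c * s = s * c"
    using nonneg_sqrt_exists[OF nonneg_square[OF sax]] by blast
  obtain k where k: "nonneg k" "k * k = s" "\<And>c. c * s = s * c \<Longrightarrow> c * k = k * c"
    using nonneg_sqrt_exists[OF s(1)] by blast
  define m where "m = s - x"
  have xs: "x * s = s * x" by (rule s(3)) (simp add: mult.assoc)
  have ms: "m * s = s * m" by (simp add: m_def algebra_simps xs)
  have mk: "m * k = k * m" by (rule k(3)) (fact ms)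
  have sam: "star m = m" by (simp add: m_def star_simps sax nonneg_selfadjoint s)
  have xm: "x * m = - (s * m)" using s(2) xs by (simp add: m_def algebra_simps)
  define q where "q = k * m"
  have saq: "star q = q" by (simp add: q_def star_simps sam nonneg_selfadjoint k mk)
  have qq: "q * q = m * s * m"
    unfolding q_def k(2)[symmetric] by (metis mk mult.assoc)
  have "star (b * m) * (b * m) = m * (x * m)" by (simp add: star_simps sam x_def mult.assoc)
  also have "\<dots> = - (q * q)" by (simp add: xm qq mult.assoc)
  finally have eq: "- (star (b * m) * (b * m)) = q * q" by simp
  then have "b * m = 0"
    using nonneg_square[OF saq] by (intro eq_zero_of_nonneg_minus_star_mult) simp
  then have "x * m = 0" by (simp add: x_def mult.assoc)
  then have "m * m = 0" using xm by (simp add: m_def algebra_simps)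
  then have "m = 0" using norm_selfadjoint_square[OF sam] by simp
  then show ?thesis using s(1) by (simp add: m_def x_def)
qed

lemma positive_imp_nonneg: "positive a \<Longrightarrow> nonneg a"
  by (auto simp: positive_def nonneg_star_mult)

lemma nonneg_conjugate: assumes "nonneg x" shows "nonneg (star a * x * a)"
proof -
  obtain s where s: "nonneg s" "s * s = x" using assms nonneg_sqrt_exists by blast
  have "star a * x * a = star (s * a) * (s * a)"
    by (simp add: s(2)[symmetric] star_simps nonneg_selfadjoint[OF s(1)] mult.assoc)
  then show ?thesis using nonneg_star_mult by simp
qed

text \<open>The one-sided inverses of \<open>1 + a\<close> are the fixed points of \<open>x \<mapsto> 1 - a x\<close> and \<open>y \<mapsto> 1 - y a\<close>.\<close>
lemma unit_plus_invertible:
  assumes "norm a < 1"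
  obtains b where "(e + a) * b = e" "b * (e + a) = e"
proof -
  have fp: "\<exists>x. x = f x" if f: "\<And>x y. norm (f x - f y) \<le> norm a * norm (x - y)" for f :: "'a \<Rightarrow> 'a"
    using banach_fix_type[of "norm a" f] assms f by (metis dist_norm norm_ge_zero)
  have "\<exists>x. x = e - a * x"
  proof (rule fp)
    fix u v
    have "norm (e - a * u - (e - a * v)) = norm (a * (u - v))"
      using norm_minus_commute[of "a * v" "a * u"] by (simp add: right_diff_distrib)
    then show "norm (e - a * u - (e - a * v)) \<le> norm a * norm (u - v)"
      using norm_mult_ineq[of a "u - v"] by simp
  qed
  then obtain x where x: "x = e - a * x" by blast
  have "\<exists>y. y = e - y * a"
  proof (rule fp)
    fix u v
    have "norm (e - u * a - (e - v * a)) = norm ((u - v) * a)"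
      using norm_minus_commute[of "v * a" "u * a"] by (simp add: left_diff_distrib)
    then show "norm (e - u * a - (e - v * a)) \<le> norm a * norm (u - v)"
      using norm_mult_ineq[of "u - v" a] by (simp add: mult.commute)
  qed
  then obtain y where y: "y = e - y * a" by blast
  have ex: "(e + a) * x = e" using x by (metis add.commute diff_add_cancel distrib_right unit_left)
  have ye: "y * (e + a) = e" using y by (metis add.commute diff_add_cancel distrib_left unit_right)
  have "y = x" by (metis ex ye mult.assoc unit_left unit_right)
  then show ?thesis using that ex ye by blast
qed

end


section \<open>Weak\<open>\<^sup>*\<close> limits\<close>

locale wstar_algebra = unital_cstar_algebra e for e :: "'a::cstar_algebra" +
  fixes P :: "('a \<Rightarrow>\<^sub>L complex) set"
  assumes predual: "wstar_predual P"
begin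

lemma predual_scaleC: "\<phi> \<in> P \<Longrightarrow> blinfun_apply \<phi> (c *\<^sub>C a) = c * blinfun_apply \<phi> a"
  using predual by (simp add: wstar_predual_def)

lemma zero_in_predual: "0 \<in> P"
  using predual by (simp add: wstar_predual_def)

lemma predual_represents:
  assumes "\<And>\<phi> \<psi>. \<phi> \<in> P \<Longrightarrow> \<psi> \<in> P \<Longrightarrow> F (\<phi> + \<psi>) = F \<phi> + F \<psi>"
    and "\<And>\<phi> \<psi> c. \<phi> \<in> P \<Longrightarrow> \<psi> \<in> P \<Longrightarrow> (\<And>a. blinfun_apply \<psi> a = c * blinfun_apply \<phi> a) \<Longrightarrow> F \<psi> = c * F \<phi>"
    and "\<And>\<phi>. \<phi> \<in> P \<Longrightarrow> cmod (F \<phi>) \<le> C * norm \<phi>"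
  shows "\<exists>a. \<forall>\<phi>\<in>P. F \<phi> = blinfun_apply \<phi> a"
proof -
  have "\<forall>F :: ('a \<Rightarrow>\<^sub>L complex) \<Rightarrow> complex.
        (\<forall>\<phi>\<in>P. \<forall>\<psi>\<in>P. F (\<phi> + \<psi>) = F \<phi> + F \<psi>) \<longrightarrow>
        (\<forall>\<phi>\<in>P. \<forall>\<psi>\<in>P. \<forall>c. (\<forall>a. blinfun_apply \<psi> a = c * blinfun_apply \<phi> a) \<longrightarrow> F \<psi> = c * F \<phi>) \<longrightarrow>
        (\<exists>C. \<forall>\<phi>\<in>P. cmod (F \<phi>) \<le> C * norm \<phi>) \<longrightarrow>
        (\<exists>a. \<forall>\<phi>\<in>P. F \<phi> = blinfun_apply \<phi> a)"
    using predual unfolding wstar_predual_def by (elim conjE)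
  then show ?thesis using assms by blast
qed

lemma predual_add_closed: "\<phi> \<in> P \<Longrightarrow> \<psi> \<in> P \<Longrightarrow> \<phi> + \<psi> \<in> P"
  using predual by (simp add: wstar_predual_def)

lemma norm_le_of_predual:
  assumes "\<And>\<phi>. \<phi> \<in> P \<Longrightarrow> norm \<phi> \<le> 1 \<Longrightarrow> cmod (blinfun_apply \<phi> a) \<le> r"
  shows "norm a \<le> r"
proof -
  have "norm a = (SUP \<phi>\<in>{\<phi>\<in>P. norm \<phi> \<le> 1}. cmod (blinfun_apply \<phi> a))"
    using predual unfolding wstar_predual_def by (elim conjE) (rule spec)
  also have "\<dots> \<le> r"
    by (rule cSUP_least) (use assms zero_in_predual in \<open>auto intro: exI[of _ 0]\<close>)
  finally show ?thesis .
qed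

lemma predual_separates:
  assumes "\<And>\<phi>. \<phi> \<in> P \<Longrightarrow> blinfun_apply \<phi> a = blinfun_apply \<phi> b"
  shows "a = b"
proof -
  have "norm (a - b) \<le> 0"
    by (rule norm_le_of_predual) (simp add: assms blinfun.diff_right)
  then show ?thesis by simp
qed

definition weak_star_lim :: "('t \<Rightarrow> 'a) \<Rightarrow> 'a \<Rightarrow> 't filter \<Rightarrow> bool" where
  "weak_star_lim X a F \<longleftrightarrow> (\<forall>\<phi>\<in>P. ((\<lambda>t. blinfun_apply \<phi> (X t)) \<longlongrightarrow> blinfun_apply \<phi> a) F)"

lemma weak_star_lim_const: "weak_star_lim (\<lambda>_. a) a F"
  by (simp add: weak_star_lim_def)

lemma weak_star_lim_add:
  "weak_star_lim X a F \<Longrightarrow> weak_star_lim Y b F \<Longrightarrow> weak_star_lim (\<lambda>t. X t + Y t) (a + b) F"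
  by (simp add: weak_star_lim_def blinfun.add_right tendsto_add)

lemma weak_star_lim_diff:
  "weak_star_lim X a F \<Longrightarrow> weak_star_lim Y b F \<Longrightarrow> weak_star_lim (\<lambda>t. X t - Y t) (a - b) F"
  by (simp add: weak_star_lim_def blinfun.diff_right tendsto_diff)

lemma weak_star_lim_scaleC:
  "weak_star_lim X a F \<Longrightarrow> weak_star_lim (\<lambda>t. c *\<^sub>C X t) (c *\<^sub>C a) F"
  by (simp add: weak_star_lim_def predual_scaleC tendsto_mult_left)

lemma weak_star_lim_unique:
  assumes "F \<noteq> bot" "weak_star_lim X a F" "weak_star_lim X b F"
  shows "a = b"
  using assms by (intro predual_separates) (auto simp: weak_star_lim_def intro: tendsto_unique)

lemma weak_star_lim_cong:
  assumes "weak_star_lim X a F" "eventually (\<lambda>t. X t = Y t) F"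
  shows "weak_star_lim Y a F"
  unfolding weak_star_lim_def
proof
  fix \<phi> assume "\<phi> \<in> P"
  then have "((\<lambda>t. blinfun_apply \<phi> (X t)) \<longlongrightarrow> blinfun_apply \<phi> a) F"
    using assms(1) by (simp add: weak_star_lim_def)
  moreover have "eventually (\<lambda>t. blinfun_apply \<phi> (X t) = blinfun_apply \<phi> (Y t)) F"
    using assms(2) by eventually_elim simp
  ultimately show "((\<lambda>t. blinfun_apply \<phi> (Y t)) \<longlongrightarrow> blinfun_apply \<phi> a) F"
    by (rule Lim_transform_eventually)
qed

lemma norm_weak_star_lim_le:
  assumes "F \<noteq> bot" "weak_star_lim X a F" "eventually (\<lambda>t. norm (X t) \<le> r) F"
  shows "norm a \<le> r"
proof (rule norm_le_of_predual)
  fix \<phi> assume \<phi>: "\<phi> \<in> P" "norm \<phi> \<le> 1"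
  have "((\<lambda>t. cmod (blinfun_apply \<phi> (X t))) \<longlongrightarrow> cmod (blinfun_apply \<phi> a)) F"
    using assms(2) \<phi>(1) by (auto simp: weak_star_lim_def intro: tendsto_norm)
  moreover have "eventually (\<lambda>t. cmod (blinfun_apply \<phi> (X t)) \<le> r) F"
    using assms(3)
  proof eventually_elim
    case (elim t)
    have "cmod (blinfun_apply \<phi> (X t)) \<le> norm \<phi> * norm (X t)" by (rule norm_blinfun)
    also have "\<dots> \<le> 1 * norm (X t)" by (rule mult_right_mono[OF \<phi>(2)]) simp
    finally show ?case using elim by simp
  qed
  ultimately show "cmod (blinfun_apply \<phi> a) \<le> r"
    by (rule tendsto_upperbound) (rule assms(1))
qed

lemma nonneg_of_all_shifts:
  assumes "\<And>d. 0 < d \<Longrightarrow> nonneg (x + d *\<^sub>R e)"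
  shows "nonneg x"
proof -
  have "star (x + 1 *\<^sub>R e) = x + 1 *\<^sub>R e" using assms[of 1] by (intro nonneg_selfadjoint) simp
  then have "star x = x" by (simp add: star_simps)
  moreover have "norm (norm x *\<^sub>R e - x) \<le> norm x"
  proof (rule field_le_epsilon)
    fix d :: real assume "0 < d"
    moreover from this have "norm (x + d *\<^sub>R e) \<le> norm x + d"
      using norm_triangle_ineq[of x "d *\<^sub>R e"] norm_scaleR_unit_le[of d] by linarith
    ultimately have "norm ((norm x + d) *\<^sub>R e - (x + d *\<^sub>R e)) \<le> norm x + d"
      using assms norm_minus_nonneg_le by blast
    then show "norm (norm x *\<^sub>R e - x) \<le> norm x + d" by (simp add: algebra_simps)
  qed
  ultimately show ?thesis by (auto simp: nonneg_def)
qed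

text \<open>
  Self-adjointness passes to a bounded weak\<open>\<^sup>*\<close> limit because the norm can detect it:
  \<open>norm (x + is) \<le> \<surd>(r\<^sup>2 + s\<^sup>2)\<close> for all real \<open>s\<close> when \<open>x\<close> is self-adjoint of norm at most \<open>r\<close>,
  and the right-hand side is \<open>\<bar>s\<bar> + o(1)\<close>, which leaves no room for an imaginary part.
\<close>
lemma selfadjoint_weak_star_lim:
  assumes F: "F \<noteq> bot" and lim: "weak_star_lim X a F"
    and ev: "eventually (\<lambda>t. star (X t) = X t \<and> norm (X t) \<le> r) F"
  shows "star a = a"
proof -
  have r0: "0 \<le> r"
    using eventually_happens'[OF F ev] norm_ge_zero order_trans by blast
  \<comment> \<open>Twice the imaginary part of \<open>a\<close>; it is shown to be both nonnegative and nonpositive.\<close>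
  define k where "k = - \<i> *\<^sub>C (a - star a)"
  have sak: "star k = k"
    by (simp add: k_def star_simps scaleC_minus_left scaleC_diff_right)
  have shifted: "norm (a + (\<i> * complex_of_real s) *\<^sub>C e) \<le> sqrt (r\<^sup>2 + s\<^sup>2)" for s
  proof (rule norm_weak_star_lim_le[OF F weak_star_lim_add[OF lim weak_star_lim_const]])
    show "eventually (\<lambda>t. norm (X t + (\<i> * complex_of_real s) *\<^sub>C e) \<le> sqrt (r\<^sup>2 + s\<^sup>2)) F"
      using ev
    proof eventually_elim
      case (elim t)
      let ?x = "X t" and ?is = "\<i> * complex_of_real s"
      have "star (?x + ?is *\<^sub>C e) * (?x + ?is *\<^sub>C e) = ?x * ?x + (complex_of_real (s * s)) *\<^sub>C e"
        using elim by (simp add: star_simps scaleC_mult scaleC_scaleC scaleC_add_right scaleC_diff_right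
            scaleC_minus_left algebra_simps)
      also have "\<dots> = ?x * ?x + (s * s) *\<^sub>R e" by (simp add: scaleR_scaleC)
      finally have "(norm (?x + ?is *\<^sub>C e))\<^sup>2 = norm (?x * ?x + (s * s) *\<^sub>R e)"
        using cstar_identity[of "?x + ?is *\<^sub>C e"] by simp
      also have "\<dots> \<le> norm (?x * ?x) + norm ((s * s) *\<^sub>R e)" by (rule norm_triangle_ineq)
      also have "\<dots> \<le> r\<^sup>2 + s\<^sup>2"
      proof (rule add_mono)
        show "norm (?x * ?x) \<le> r\<^sup>2" using elim norm_selfadjoint_square[of ?x] by (simp add: power_mono)
        show "norm ((s * s) *\<^sub>R e) \<le> s\<^sup>2"
          using norm_scaleR_unit_le[of "s * s"] by (simp add: power2_eq_square)
      qed
      finally show ?case by (rule real_le_rsqrt)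
    qed
  qed
  have k_shift: "norm (k + (2 * s) *\<^sub>R e) \<le> 2 * sqrt (r\<^sup>2 + s\<^sup>2)" for s
  proof -
    let ?z = "a + (\<i> * complex_of_real s) *\<^sub>C e"
    have "k + (2 * s) *\<^sub>R e = - \<i> *\<^sub>C (?z - star ?z)"
    proof -
      have "(2 * s) *\<^sub>R e = (complex_of_real s) *\<^sub>C e + (complex_of_real s) *\<^sub>C e"
        by (simp add: scaleR_scaleC scaleC_add_left[symmetric])
      then show ?thesis
        by (simp add: k_def star_simps scaleC_diff_right scaleC_add_right scaleC_scaleC
            scaleC_minus_left scaleC_minus_right algebra_simps)
    qed
    then have "norm (k + (2 * s) *\<^sub>R e) = norm (?z - star ?z)" by (simp add: norm_scaleC)
    also have "\<dots> \<le> 2 * norm ?z" using norm_triangle_ineq4[of ?z "star ?z"] by simp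
    finally show ?thesis using shifted[of s] by linarith
  qed
  \<comment> \<open>The distance of \<open>\<surd>(r\<^sup>2 + s\<^sup>2)\<close> from its asymptote \<open>s\<close> is below \<open>d/2\<close> for this \<open>s\<close>.\<close>
  have sqrt_bound: "2 * sqrt (r\<^sup>2 + s\<^sup>2) \<le> 2 * s + d" if "0 < d" "s = (r\<^sup>2 + 1) / d" for s d :: real
  proof -
    have "0 < s" "s * d = r\<^sup>2 + 1" using that by (auto simp: add_nonneg_pos)
    then have "r\<^sup>2 + s\<^sup>2 \<le> (s + d / 2)\<^sup>2" by (simp add: power2_eq_square algebra_simps)
    then have "sqrt (r\<^sup>2 + s\<^sup>2) \<le> s + d / 2"
      using \<open>0 < s\<close> that(1) by (intro real_le_lsqrt) auto
    then show ?thesis by simp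
  qed
  have "nonneg (- k)"
  proof (rule nonneg_of_all_shifts)
    fix d :: real assume d: "0 < d"
    let ?s = "(r\<^sup>2 + 1) / d"
    have "nonneg ((2 * ?s + d) *\<^sub>R e - (k + (2 * ?s) *\<^sub>R e))"
      using k_shift[of ?s] sqrt_bound[OF d refl]
      by (intro nonneg_norm_minus) (auto simp: star_simps sak)
    then show "nonneg (- k + d *\<^sub>R e)" by (simp add: algebra_simps)
  qed
  moreover have "nonneg k"
  proof (rule nonneg_of_all_shifts)
    fix d :: real assume d: "0 < d"
    let ?s = "(r\<^sup>2 + 1) / d"
    have "norm (- k + (2 * ?s) *\<^sub>R e) = norm (k + (2 * - ?s) *\<^sub>R e)"
      using norm_minus_cancel[of "k + (2 * - ?s) *\<^sub>R e"] by simp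
    then have "nonneg ((2 * ?s + d) *\<^sub>R e - (- k + (2 * ?s) *\<^sub>R e))"
      using k_shift[of "- ?s"] sqrt_bound[OF d refl]
      by (intro nonneg_norm_minus) (auto simp: star_simps sak)
    then show "nonneg (k + d *\<^sub>R e)" by (simp add: algebra_simps)
  qed
  ultimately have "k = 0" using nonneg_antisym by blast
  then have "\<i> *\<^sub>C - \<i> *\<^sub>C (a - star a) = 0" by (simp add: k_def)
  then show ?thesis by (simp add: scaleC_scaleC scaleC_one)
qed

lemma nonneg_weak_star_lim:
  assumes F: "F \<noteq> bot" and lim: "weak_star_lim X a F"
    and ev: "eventually (\<lambda>t. nonneg (X t)) F" "eventually (\<lambda>t. norm (X t) \<le> r) F"
  shows "nonneg a"
proof -
  have "star a = a"
    by (rule selfadjoint_weak_star_lim[OF F lim, of r])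
      (use ev in eventually_elim, auto simp: nonneg_selfadjoint)
  moreover have "norm (r *\<^sub>R e - a) \<le> r"
    by (rule norm_weak_star_lim_le[OF F weak_star_lim_diff[OF weak_star_lim_const lim]])
      (use ev in eventually_elim, rule norm_minus_nonneg_le)
  ultimately show ?thesis by (auto simp: nonneg_def)
qed

text \<open>
  The Banach-Alaoglu theorem, in the form of a refinement of the given filter along which a whole
  family of bounded functions converges at once; the refined filter takes the role of an ultrafilter.
\<close>
lemma weak_star_convergent_refinement:
  fixes X :: "'i \<Rightarrow> 't \<Rightarrow> 'a"
  assumes F: "F \<noteq> bot" and bd: "eventually (\<lambda>t. \<forall>i\<in>I. norm (X i t) \<le> r i) F"
  obtains G Y where "G \<le> F" "G \<noteq> bot" "\<And>i. i \<in> I \<Longrightarrow> weak_star_lim (X i) (Y i) G"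
proof -
  \<comment> \<open>All coordinates of all functions as one point of a product of discs, which is compact; off the
    relevant indices the coordinate is \<open>0\<close>.\<close>
  define ev :: "'t \<Rightarrow> 'i \<times> ('a \<Rightarrow>\<^sub>L complex) \<Rightarrow> complex" where
    "ev t = (\<lambda>(i, \<phi>). if i \<in> I \<and> \<phi> \<in> P then blinfun_apply \<phi> (X i t) else 0)" for t
  define B :: "'i \<times> ('a \<Rightarrow>\<^sub>L complex) \<Rightarrow> complex set" where
    "B = (\<lambda>(i, \<phi>). cball 0 (if i \<in> I \<and> \<phi> \<in> P then norm \<phi> * r i else 0))"
  have "compactin (product_topology (\<lambda>_. euclidean) UNIV) (PiE UNIV B)"
    by (subst compactin_PiE) (auto simp: B_def)
  then have K: "compact (PiE UNIV B)"
    by (simp add: euclidean_product_topology)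
  have evK: "eventually (\<lambda>y. y \<in> PiE UNIV B) (filtermap ev F)"
    unfolding eventually_filtermap using bd
  proof eventually_elim
    case (elim t)
    have "ev t (i, \<phi>) \<in> B (i, \<phi>)" for i \<phi>
      using elim norm_blinfun[of \<phi> "X i t"] mult_left_mono[of "norm (X i t)" "r i" "norm \<phi>"]
      by (auto simp: ev_def B_def intro: order_trans)
    then show ?case by (auto simp: PiE_UNIV_domain)
  qed
  obtain x where x: "x \<in> PiE UNIV B" "inf (nhds x) (filtermap ev F) \<noteq> bot"
    using K F evK unfolding compact_filter by (metis filtermap_bot_iff)
  \<comment> \<open>The trace on \<open>F\<close> of the neighbourhoods of a cluster point.\<close>
  define G where "G = inf F (filtercomap ev (nhds x))"
  have G: "G \<noteq> bot"
  proof
    assume "G = bot"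
    then have "eventually (\<lambda>_. False) G" by simp
    then obtain Q R where Q: "eventually Q F" and R: "eventually R (filtercomap ev (nhds x))"
      and QR: "\<And>t. Q t \<Longrightarrow> R t \<Longrightarrow> False"
      unfolding G_def eventually_inf by blast
    obtain U where U: "eventually U (nhds x)" "\<And>t. U (ev t) \<Longrightarrow> R t"
      using R unfolding eventually_filtercomap by blast
    have "eventually (\<lambda>y. \<not> U y) (filtermap ev F)"
      unfolding eventually_filtermap using Q by eventually_elim (use QR U in blast)
    then have "eventually (\<lambda>_. False) (inf (nhds x) (filtermap ev F))"
      unfolding eventually_inf using U(1) by blast
    then show False using x(2) by (simp add: trivial_limit_def)
  qed
  have "filterlim ev (nhds x) G"
    unfolding G_def by (rule filterlim_mono[OF filterlim_filtercomap order_refl inf_le2])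
  then have coord: "((\<lambda>t. ev t j) \<longlongrightarrow> x j) G" for j
    by (rule continuous_on_tendsto_compose[OF continuous_on_product_coordinates]) simp_all
  have lim: "((\<lambda>t. blinfun_apply \<phi> (X i t)) \<longlongrightarrow> x (i, \<phi>)) G" if "i \<in> I" "\<phi> \<in> P" for i \<phi>
    using coord[of "(i, \<phi>)"] that by (simp add: ev_def)
  have "\<exists>a. \<forall>\<phi>\<in>P. x (i, \<phi>) = blinfun_apply \<phi> a" if i: "i \<in> I" for i
  proof (rule predual_represents)
    fix \<phi> \<psi> assume *: "\<phi> \<in> P" "\<psi> \<in> P"
    have "((\<lambda>t. blinfun_apply (\<phi> + \<psi>) (X i t)) \<longlongrightarrow> x (i, \<phi>) + x (i, \<psi>)) G"
      unfolding blinfun.add_left by (intro tendsto_add lim i *)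
    then show "x (i, \<phi> + \<psi>) = x (i, \<phi>) + x (i, \<psi>)"
      using tendsto_unique[OF G lim[OF i predual_add_closed[OF *]]] by blast
  next
    fix \<phi> \<psi> c assume *: "\<phi> \<in> P" "\<psi> \<in> P" "\<And>a. blinfun_apply \<psi> a = c * blinfun_apply \<phi> a"
    then show "x (i, \<psi>) = c * x (i, \<phi>)"
      using tendsto_unique[OF G lim[OF i *(2)]] tendsto_mult_left[OF lim[OF i *(1)], of c] by simp
  next
    fix \<phi> assume "\<phi> \<in> P"
    then show "cmod (x (i, \<phi>)) \<le> r i * norm \<phi>"
      using PiE_mem[OF x(1), of "(i, \<phi>)"] i by (simp add: B_def mult.commute)
  qed
  then obtain Y where Y: "\<And>i. i \<in> I \<Longrightarrow> \<forall>\<phi>\<in>P. x (i, \<phi>) = blinfun_apply \<phi> (Y i)" by metis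
  show ?thesis
  proof (rule that[OF _ G])
    show "G \<le> F" by (simp add: G_def)
    show "weak_star_lim (X i) (Y i) G" if "i \<in> I" for i
      unfolding weak_star_lim_def using lim[OF that] Y[OF that] by auto
  qed
qed

end


section \<open>Hilbert modules over a unital algebra\<close>

locale unital_hilbert_module =
  unital_cstar_algebra e + hilbert_module V sc act ip
  for e :: "'a::cstar_algebra" and V :: "'v::ab_group_add set"
    and sc :: "complex \<Rightarrow> 'v \<Rightarrow> 'v" and act :: "'v \<Rightarrow> 'a \<Rightarrow> 'v" and ip :: "'v \<Rightarrow> 'v \<Rightarrow> 'a"
begin

lemma zero_closed [simp]: "0 \<in> V"
  and add_closed [simp]: "x \<in> V \<Longrightarrow> y \<in> V \<Longrightarrow> x + y \<in> V"
  and sc_closed [simp]: "x \<in> V \<Longrightarrow> sc c x \<in> V"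
  and act_closed [simp]: "x \<in> V \<Longrightarrow> act x a \<in> V"
  using closed_operations by (auto simp: submodule_def)

lemma sc_minus_one: "x \<in> V \<Longrightarrow> sc (- 1) x = - x"
proof -
  assume x: "x \<in> V"
  have "sc 0 x = 0" using sc_add_left[OF x, of 0 0] by simp
  then show ?thesis using sc_add_left[OF x, of 1 "- 1"] sc_one[OF x]
    by (simp add: eq_neg_iff_add_eq_0 add.commute)
qed

lemma minus_closed [simp]: "x \<in> V \<Longrightarrow> - x \<in> V"
  using sc_closed[of x "- 1"] by (simp add: sc_minus_one)

lemma diff_closed [simp]: "x \<in> V \<Longrightarrow> y \<in> V \<Longrightarrow> x - y \<in> V"
  using add_closed[of x "- y"] by simp

lemma ip_zero_right [simp]: "x \<in> V \<Longrightarrow> ip x 0 = 0"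
  using ip_add[of x 0 0] by simp

lemma ip_minus_right: "x \<in> V \<Longrightarrow> y \<in> V \<Longrightarrow> ip x (- y) = - ip x y"
  using ip_add[of x y "- y"] by (simp add: eq_neg_iff_add_eq_0 add.commute)

lemma ip_diff_right: "x \<in> V \<Longrightarrow> y \<in> V \<Longrightarrow> z \<in> V \<Longrightarrow> ip x (y - z) = ip x y - ip x z"
  using ip_add[of x y "- z"] by (simp add: ip_minus_right)

lemma ip_add_left: "x \<in> V \<Longrightarrow> y \<in> V \<Longrightarrow> z \<in> V \<Longrightarrow> ip (x + y) z = ip x z + ip y z"
  by (metis add_closed ip_add ip_star star_add)

lemma ip_diff_left: "x \<in> V \<Longrightarrow> y \<in> V \<Longrightarrow> z \<in> V \<Longrightarrow> ip (x - y) z = ip x z - ip y z"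
  by (metis diff_closed ip_diff_right ip_star star_diff)

lemma ip_sc_left: "x \<in> V \<Longrightarrow> y \<in> V \<Longrightarrow> ip (sc c x) y = cnj c *\<^sub>C ip x y"
  by (metis ip_sc ip_star sc_closed star_scaleC)

lemma ip_act_left: "x \<in> V \<Longrightarrow> y \<in> V \<Longrightarrow> ip (act x a) y = star a * ip x y"
  by (metis act_closed ip_act ip_star star_mult)

lemma ip_zero_left [simp]: "x \<in> V \<Longrightarrow> ip 0 x = 0"
  by (metis ip_star ip_zero_right star_zero zero_closed)

lemma eq_of_ip_eq:
  assumes "x \<in> V" "y \<in> V" "\<And>z. z \<in> V \<Longrightarrow> ip z x = ip z y"
  shows "x = y"
proof -
  have "ip (x - y) (x - y) = 0" using assms by (simp add: ip_diff_right)
  then have "x - y = 0" using assms by (intro ip_definite) auto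
  then show ?thesis by simp
qed

lemma act_unit: "x \<in> V \<Longrightarrow> act x e = x"
  by (rule eq_of_ip_eq) (simp_all add: ip_act)

lemma nonneg_ip: "x \<in> V \<Longrightarrow> nonneg (ip x x)"
  using ip_positive positive_imp_nonneg by blast

lemma nonneg_ip_ip: "x \<in> V \<Longrightarrow> y \<in> V \<Longrightarrow> nonneg (ip y x * ip x y)"
  using nonneg_star_mult[of "ip x y"] by (simp add: ip_star)

text \<open>
  Expand \<open>\<langle>w, w\<rangle> \<ge> 0\<close> for \<open>w = y - x\<langle>x, y\<rangle>/r\<close> with \<open>r = norm \<langle>x, x\<rangle>\<close>. The quadratic term is at
  most \<open>\<langle>y, x\<rangle>\<langle>x, y\<rangle>/r\<close> because \<open>\<langle>x, x\<rangle> \<le> r\<close>.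
\<close>
lemma Cauchy_Schwarz_nonneg:
  assumes x: "x \<in> V" and y: "y \<in> V"
  shows "nonneg (norm (ip x x) *\<^sub>R ip y y - ip y x * ip x y)"
proof (cases "ip x x = 0")
  case True
  then show ?thesis using ip_definite[OF x] y by simp
next
  case False
  define r where "r = norm (ip x x)"
  have r: "0 < r" using False by (simp add: r_def)
  let ?a = "ip x y" and ?b = "(1 / r) *\<^sub>R ip x y"
  let ?X = "ip y x * ip x y"
  have sb: "star ?b = (1 / r) *\<^sub>R ip y x" by (simp add: star_simps ip_star x y)
  let ?w = "y - act x ?b"
  have 1: "nonneg (ip ?w ?w)" by (rule nonneg_ip) (simp add: x y)
  have w: "ip ?w ?w = ip y y - (2 / r) *\<^sub>R ?X + (1 / r\<^sup>2) *\<^sub>R (ip y x * ip x x * ip x y)"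
  proof -
    have "ip ?w ?w = ip y y - ip y x * ?b - star ?b * ip x y + star ?b * ip x x * ?b"
      by (simp add: ip_diff_left ip_diff_right ip_act ip_act_left x y mult.assoc algebra_simps)
    also have "\<dots> = ip y y - ((1 / r) *\<^sub>R ?X + (1 / r) *\<^sub>R ?X) + (1 / r\<^sup>2) *\<^sub>R (ip y x * ip x x * ip x y)"
      unfolding sb by (simp add: power2_eq_square)
    also have "(1 / r) *\<^sub>R ?X + (1 / r) *\<^sub>R ?X = (2 / r) *\<^sub>R ?X"
      by (simp add: scaleR_add_left[symmetric])
    finally show ?thesis .
  qed
  have "nonneg (r *\<^sub>R e - ip x x)"
    by (rule nonneg_norm_minus) (simp_all add: r_def ip_star x)
  then have "nonneg (star ?a * (r *\<^sub>R e - ip x x) * ?a)" by (rule nonneg_conjugate)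
  then have 2: "nonneg (r *\<^sub>R ?X - ip y x * ip x x * ip x y)"
    by (simp add: ip_star x y algebra_simps)
  have "nonneg (r *\<^sub>R (ip ?w ?w + (1 / r\<^sup>2) *\<^sub>R (r *\<^sub>R ?X - ip y x * ip x x * ip x y)))"
    using r by (intro nonneg_scaleR nonneg_add 1 2) auto
  also have "r *\<^sub>R (ip ?w ?w + (1 / r\<^sup>2) *\<^sub>R (r *\<^sub>R ?X - ip y x * ip x x * ip x y)) =
      r *\<^sub>R ip y y - ?X"
  proof -
    have "ip ?w ?w + (1 / r\<^sup>2) *\<^sub>R (r *\<^sub>R ?X - ip y x * ip x x * ip x y) =
        ip y y - (2 / r) *\<^sub>R ?X + (1 / r) *\<^sub>R ?X"
      unfolding w using r by (simp add: scaleR_diff_right power2_eq_square)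
    also have "\<dots> = ip y y - (1 / r) *\<^sub>R ?X"
      using scaleR_add_left[of "1 / r" "1 / r" ?X] by simp
    finally show ?thesis using r by (simp add: scaleR_diff_right)
  qed
  finally show ?thesis by (simp add: r_def)
qed

lemma ip_norm_nonneg [simp]: "0 \<le> ip_norm ip x"
  by (simp add: ip_norm_def)

lemma ip_norm_square: "(ip_norm ip x)\<^sup>2 = norm (ip x x)"
  by (simp add: ip_norm_def)

lemma Cauchy_Schwarz:
  assumes x: "x \<in> V" and y: "y \<in> V"
  shows "norm (ip x y) \<le> ip_norm ip x * ip_norm ip y"
proof -
  have "(norm (ip x y))\<^sup>2 = norm (ip y x * ip x y)"
    using cstar_identity[of "ip x y"] by (simp add: ip_star x y)
  also have "\<dots> \<le> norm (norm (ip x x) *\<^sub>R ip y y)"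
    by (rule norm_mono[OF nonneg_ip_ip[OF x y] Cauchy_Schwarz_nonneg[OF x y]])
  also have "\<dots> = (ip_norm ip x * ip_norm ip y)\<^sup>2"
    by (simp add: power_mult_distrib ip_norm_square)
  finally show ?thesis by (rule power2_le_imp_le) simp
qed

lemma ip_norm_eq_zero: "x \<in> V \<Longrightarrow> ip_norm ip x = 0 \<longleftrightarrow> x = 0"
  using ip_definite by (auto simp: ip_norm_def)

lemma ip_norm_sc: "x \<in> V \<Longrightarrow> ip_norm ip (sc c x) = cmod c * ip_norm ip x"
  by (simp add: ip_norm_def ip_sc ip_sc_left norm_scaleC real_sqrt_mult scaleC_scaleC norm_mult)

lemma ip_norm_minus: "x \<in> V \<Longrightarrow> ip_norm ip (- x) = ip_norm ip x"
  using ip_norm_sc[of x "- 1"] by (simp add: sc_minus_one)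

lemma ip_norm_triangle:
  assumes x: "x \<in> V" and y: "y \<in> V"
  shows "ip_norm ip (x + y) \<le> ip_norm ip x + ip_norm ip y"
proof -
  have "(ip_norm ip (x + y))\<^sup>2 = norm ((ip x x + ip y x) + (ip x y + ip y y))"
    by (simp add: ip_norm_square ip_add ip_add_left x y)
  also have "\<dots> \<le> (norm (ip x x) + norm (ip y x)) + (norm (ip x y) + norm (ip y y))"
    by (intro norm_triangle_mono) auto
  also have "\<dots> \<le> (ip_norm ip x + ip_norm ip y)\<^sup>2"
    using Cauchy_Schwarz[OF x y] Cauchy_Schwarz[OF y x]
    by (simp add: ip_norm_square[symmetric] power2_eq_square algebra_simps)
  finally show ?thesis by (rule power2_le_imp_le) simp
qed

lemma metric_space: "Metric_space V (ip_dist V ip)"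
proof
  fix x y z
  show "0 \<le> ip_dist V ip x y" by (simp add: ip_dist_def)
  show "ip_dist V ip x y = ip_dist V ip y x"
    using ip_norm_minus[of "x - y"] by (auto simp: ip_dist_def)
  show "ip_dist V ip x y = 0 \<longleftrightarrow> x = y" if "x \<in> V" "y \<in> V"
    using that by (simp add: ip_dist_def ip_norm_eq_zero)
  show "ip_dist V ip x z \<le> ip_dist V ip x y + ip_dist V ip y z" if "x \<in> V" "y \<in> V" "z \<in> V"
    using that ip_norm_triangle[of "x - y" "y - z"] by (simp add: ip_dist_def)
qed

text \<open>Polarization, with the diagonal values at \<open>x + y\<close> and \<open>x + iy\<close>.\<close>
lemma sesquilinear_eq_zero:
  fixes \<Phi> :: "'v \<Rightarrow> 'v \<Rightarrow> 'a"
  assumes add: "\<And>x y z. x \<in> V \<Longrightarrow> y \<in> V \<Longrightarrow> z \<in> V \<Longrightarrow> \<Phi> x (y + z) = \<Phi> x y + \<Phi> x z"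
    "\<And>x y z. x \<in> V \<Longrightarrow> y \<in> V \<Longrightarrow> z \<in> V \<Longrightarrow> \<Phi> (x + y) z = \<Phi> x z + \<Phi> y z"
    and scale: "\<And>x y c. x \<in> V \<Longrightarrow> y \<in> V \<Longrightarrow> \<Phi> x (sc c y) = c *\<^sub>C \<Phi> x y"
    "\<And>x y c. x \<in> V \<Longrightarrow> y \<in> V \<Longrightarrow> \<Phi> (sc c x) y = cnj c *\<^sub>C \<Phi> x y"
    and diag: "\<And>x. x \<in> V \<Longrightarrow> \<Phi> x x = 0"
    and x: "x \<in> V" and y: "y \<in> V"
  shows "\<Phi> x y = 0"
proof -
  have 1: "\<Phi> x y + \<Phi> y x = 0"
    using diag[of "x + y"] diag[OF x] diag[OF y] x y by (simp add: add add.commute)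
  have "\<Phi> (x + sc \<i> y) (x + sc \<i> y) = \<i> *\<^sub>C \<Phi> x y - \<i> *\<^sub>C \<Phi> y x"
    using diag[OF x] diag[OF y] x y
    by (simp add: add scale scaleC_scaleC scaleC_minus_left)
  then have "\<i> *\<^sub>C (\<Phi> x y - \<Phi> y x) = 0"
    using diag[of "x + sc \<i> y"] x y by (simp add: scaleC_diff_right)
  then have "- \<i> *\<^sub>C \<i> *\<^sub>C (\<Phi> x y - \<Phi> y x) = 0" by simp
  then have "\<Phi> x y = \<Phi> y x" by (simp add: scaleC_scaleC scaleC_one)
  then have "2 *\<^sub>R \<Phi> x y = 0" using 1 by (simp add: scaleR_2)
  then show ?thesis by simp
qed

end


section \<open>Weak\<open>\<^sup>*\<close> closures in a Hilbert module over a \<open>W\<^sup>*\<close>-algebra\<close>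

locale wstar_hilbert_module =
  wstar_algebra e P + unital_hilbert_module e V sc act ip
  for e :: "'a::cstar_algebra" and P and V :: "'v::ab_group_add set"
    and sc :: "complex \<Rightarrow> 'v \<Rightarrow> 'v" and act :: "'v \<Rightarrow> 'a \<Rightarrow> 'v" and ip :: "'v \<Rightarrow> 'v \<Rightarrow> 'a"
begin

text \<open>
  The closure in the weak\<open>\<^sup>*\<close> topology, spelled out through finitely many of the functionals
  \<open>f \<mapsto> \<phi> \<langle>g, f\<rangle>\<close> and a common tolerance. In this form it is visibly
  stable under limits, and a group if the given set is one.
\<close>
definition weak_closure :: "'v set \<Rightarrow> 'v set" where
  "weak_closure N = {f \<in> V. \<forall>B d. finite B \<and> B \<subseteq> V \<times> P \<and> 0 < d \<longrightarrow>
     (\<exists>n\<in>N. \<forall>(g, \<phi>)\<in>B. cmod (blinfun_apply \<phi> (ip g (n - f))) < d)}"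

lemma weak_closureD:
  assumes "f \<in> weak_closure N" "finite B" "B \<subseteq> V \<times> P" "0 < d"
  obtains n where "n \<in> N" "\<And>g \<phi>. (g, \<phi>) \<in> B \<Longrightarrow> cmod (blinfun_apply \<phi> (ip g (n - f))) < d"
proof -
  have "\<exists>n\<in>N. \<forall>(g, \<phi>)\<in>B. cmod (blinfun_apply \<phi> (ip g (n - f))) < d"
    using assms by (simp add: weak_closure_def)
  then show ?thesis using that by blast
qed

lemma weak_closureI:
  assumes "f \<in> V"
    and "\<And>B d. finite B \<Longrightarrow> B \<subseteq> V \<times> P \<Longrightarrow> 0 < d \<Longrightarrow>
      \<exists>n\<in>N. \<forall>g \<phi>. (g, \<phi>) \<in> B \<longrightarrow> cmod (blinfun_apply \<phi> (ip g (n - f))) < d"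
  shows "f \<in> weak_closure N"
  unfolding weak_closure_def mem_Collect_eq
proof (intro conjI allI impI assms(1))
  fix B and d :: real assume "finite B \<and> B \<subseteq> V \<times> P \<and> 0 < d"
  then obtain n where "n \<in> N" "\<forall>g \<phi>. (g, \<phi>) \<in> B \<longrightarrow> cmod (blinfun_apply \<phi> (ip g (n - f))) < d"
    using assms(2)[of B d] by auto
  then show "\<exists>n\<in>N. \<forall>(g, \<phi>)\<in>B. cmod (blinfun_apply \<phi> (ip g (n - f))) < d" by blast
qed

lemma weak_closure_subset: "weak_closure N \<subseteq> V"
  by (auto simp: weak_closure_def)

lemma subset_weak_closure: assumes "N \<subseteq> V" shows "N \<subseteq> weak_closure N"
proof
  fix f assume f: "f \<in> N"
  show "f \<in> weak_closure N"
  proof (rule weak_closureI)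
    show "f \<in> V" using f assms by blast
  next
    fix B and d :: real assume "B \<subseteq> V \<times> P" "0 < d"
    then show "\<exists>n\<in>N. \<forall>g \<phi>. (g, \<phi>) \<in> B \<longrightarrow> cmod (blinfun_apply \<phi> (ip g (n - f))) < d"
      using f by (intro bexI[of _ f]) (auto simp: blinfun.zero_right)
  qed
qed

lemma weak_closure_diff:
  assumes N: "N \<subseteq> V" "\<And>m n. m \<in> N \<Longrightarrow> n \<in> N \<Longrightarrow> m - n \<in> N"
    and f: "f \<in> weak_closure N" and h: "h \<in> weak_closure N"
  shows "f - h \<in> weak_closure N"
proof (rule weak_closureI)
  have V: "f \<in> V" "h \<in> V" using f h weak_closure_subset by auto
  then show "f - h \<in> V" by simp
  fix B and d :: real assume B: "finite B" "B \<subseteq> V \<times> P" "0 < d"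
  obtain m where m: "m \<in> N" "\<And>g \<phi>. (g, \<phi>) \<in> B \<Longrightarrow> cmod (blinfun_apply \<phi> (ip g (m - f))) < d / 2"
    using weak_closureD[OF f B(1,2), of "d / 2"] B(3) by auto
  obtain n where n: "n \<in> N" "\<And>g \<phi>. (g, \<phi>) \<in> B \<Longrightarrow> cmod (blinfun_apply \<phi> (ip g (n - h))) < d / 2"
    using weak_closureD[OF h B(1,2), of "d / 2"] B(3) by auto
  show "\<exists>n\<in>N. \<forall>g \<phi>. (g, \<phi>) \<in> B \<longrightarrow> cmod (blinfun_apply \<phi> (ip g (n - (f - h)))) < d"
  proof (intro bexI allI impI)
    show "m - n \<in> N" using m n N by blast
    fix g \<phi> assume g: "(g, \<phi>) \<in> B"
    then have gV: "g \<in> V" using B by blast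
    have mnV: "m \<in> V" "n \<in> V" using m n N by auto
    have "blinfun_apply \<phi> (ip g (m - n - (f - h))) =
        blinfun_apply \<phi> (ip g (m - f)) - blinfun_apply \<phi> (ip g (n - h))"
      using gV mnV V by (simp add: ip_diff_right blinfun.diff_right)
    then show "cmod (blinfun_apply \<phi> (ip g (m - n - (f - h)))) < d"
      using m(2)[OF g] n(2)[OF g]
        norm_triangle_ineq4[of "blinfun_apply \<phi> (ip g (m - f))" "blinfun_apply \<phi> (ip g (n - h))"]
      by simp
  qed
qed

lemma weak_closure_limit:
  assumes N: "N \<subseteq> V" and f: "f \<in> V" and F: "F \<noteq> bot"
    and ev: "eventually (\<lambda>t. X t \<in> weak_closure N) F"
    and lim: "\<And>g. g \<in> V \<Longrightarrow> weak_star_lim (\<lambda>t. ip g (X t)) (ip g f) F"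
  shows "f \<in> weak_closure N"
proof (rule weak_closureI[OF f])
  fix B and d :: real assume B: "finite B" "B \<subseteq> V \<times> P" "0 < d"
  have "eventually (\<lambda>t. \<forall>b\<in>B. cmod (blinfun_apply (snd b) (ip (fst b) (X t)) -
      blinfun_apply (snd b) (ip (fst b) f)) < d / 2) F"
  proof (intro eventually_ball_finite B ballI)
    fix b assume "b \<in> B"
    then have "((\<lambda>t. blinfun_apply (snd b) (ip (fst b) (X t))) \<longlongrightarrow> blinfun_apply (snd b) (ip (fst b) f)) F"
      using lim[of "fst b"] B(2) by (auto simp: weak_star_lim_def)
    then show "eventually (\<lambda>t. cmod (blinfun_apply (snd b) (ip (fst b) (X t)) -
        blinfun_apply (snd b) (ip (fst b) f)) < d / 2) F"
      using B(3) tendstoD[of _ _ F "d / 2"] by (fastforce simp: dist_norm)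
  qed
  then have "eventually (\<lambda>t. X t \<in> weak_closure N \<and> (\<forall>b\<in>B. cmod (blinfun_apply (snd b) (ip (fst b) (X t)) -
      blinfun_apply (snd b) (ip (fst b) f)) < d / 2)) F"
    using ev by eventually_elim simp
  then obtain t where t: "X t \<in> weak_closure N"
    "\<And>b. b \<in> B \<Longrightarrow> cmod (blinfun_apply (snd b) (ip (fst b) (X t)) - blinfun_apply (snd b) (ip (fst b) f)) < d / 2"
    using eventually_happens'[OF F] by blast
  obtain n where n: "n \<in> N" "\<And>g \<phi>. (g, \<phi>) \<in> B \<Longrightarrow> cmod (blinfun_apply \<phi> (ip g (n - X t))) < d / 2"
    using weak_closureD[OF t(1) B(1,2), of "d / 2"] B(3) by auto
  show "\<exists>n\<in>N. \<forall>g \<phi>. (g, \<phi>) \<in> B \<longrightarrow> cmod (blinfun_apply \<phi> (ip g (n - f))) < d"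
  proof (intro bexI allI impI)
    fix g \<phi> assume g: "(g, \<phi>) \<in> B"
    then have gV: "g \<in> V" using B by blast
    have V: "n \<in> V" "X t \<in> V" using n N weak_closure_subset[THEN subsetD, OF t(1)] by auto
    have "blinfun_apply \<phi> (ip g (n - f)) = blinfun_apply \<phi> (ip g (n - X t)) +
        (blinfun_apply \<phi> (ip g (X t)) - blinfun_apply \<phi> (ip g f))"
      using gV V f by (simp add: ip_diff_right blinfun.diff_right)
    then show "cmod (blinfun_apply \<phi> (ip g (n - f))) < d"
      using n(2)[OF g] t(2)[OF g]
        norm_triangle_ineq[of "blinfun_apply \<phi> (ip g (n - X t))"
          "blinfun_apply \<phi> (ip g (X t)) - blinfun_apply \<phi> (ip g f)"]
      by simp
  qed (fact n)
qed

lemma weak_star_topology_nbhd: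
  assumes U: "openin (weak_star_topology P V ip) U" and f: "f \<in> U" "f \<in> V"
  obtains B d where "finite B" "B \<subseteq> V \<times> P" "0 < d"
    "\<And>x. x \<in> V \<Longrightarrow> (\<And>g \<phi>. (g, \<phi>) \<in> B \<Longrightarrow> cmod (blinfun_apply \<phi> (ip g (x - f))) < d) \<Longrightarrow> x \<in> U"
proof -
  define nb where "nb B d = {x \<in> V. \<forall>b\<in>B. cmod (blinfun_apply (snd b) (ip (fst b) (x - f))) < d}" for B d
  have mono: "nb B d \<subseteq> nb B' d'" if "B' \<subseteq> B" "d \<le> d'" for B B' d d'
    using that by (auto simp: nb_def intro: less_le_trans)
  have "generate_topology_on {{f \<in> V. blinfun_apply \<phi> (ip g f) \<in> W} | g \<phi> W. g \<in> V \<and> \<phi> \<in> P \<and> open W} U"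
    using U unfolding weak_star_topology_def openin_topology_generated_by_iff .
  then have "f \<in> U \<Longrightarrow> \<exists>B d. finite B \<and> B \<subseteq> V \<times> P \<and> 0 < d \<and> nb B d \<subseteq> U"
  proof (induction rule: generate_topology_on.induct)
    case (Int U1 U2)
    from Int.IH(1) Int.prems obtain B1 d1
      where 1: "finite B1" "B1 \<subseteq> V \<times> P" "0 < d1" "nb B1 d1 \<subseteq> U1" by blast
    from Int.IH(2) Int.prems obtain B2 d2
      where 2: "finite B2" "B2 \<subseteq> V \<times> P" "0 < d2" "nb B2 d2 \<subseteq> U2" by blast
    have "nb (B1 \<union> B2) (min d1 d2) \<subseteq> nb B1 d1" "nb (B1 \<union> B2) (min d1 d2) \<subseteq> nb B2 d2"
      by (rule mono; simp)+
    then have "nb (B1 \<union> B2) (min d1 d2) \<subseteq> U1 \<inter> U2" using 1(4) 2(4) by blast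
    then show ?case using 1 2 by (intro exI[of _ "B1 \<union> B2"] exI[of _ "min d1 d2"]) simp
  next
    case (UN K)
    then obtain U where "U \<in> K" "f \<in> U" by blast
    with UN.IH[of U] obtain B d
      where "finite B" "B \<subseteq> V \<times> P" "0 < d" "nb B d \<subseteq> U" by blast
    then show ?case using \<open>U \<in> K\<close> by (intro exI[of _ B] exI[of _ d]) auto
  next
    case (Basis U)
    then obtain g \<phi> W where U: "U = {f \<in> V. blinfun_apply \<phi> (ip g f) \<in> W}" "g \<in> V" "\<phi> \<in> P" "open W"
      by blast
    then obtain d where d: "0 < d" "ball (blinfun_apply \<phi> (ip g f)) d \<subseteq> W"
      using Basis.prems open_contains_ball by blast
    have "x \<in> U" if "x \<in> V" "cmod (blinfun_apply \<phi> (ip g (x - f))) < d" for x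
    proof -
      have "blinfun_apply \<phi> (ip g x) \<in> ball (blinfun_apply \<phi> (ip g f)) d"
        using that f(2) U(2)
        by (simp add: dist_norm norm_minus_commute ip_diff_right blinfun.diff_right)
      then show ?thesis using d(2) U(1) that(1) by blast
    qed
    then have "nb {(g, \<phi>)} d \<subseteq> U" by (auto simp: nb_def)
    then show ?case using U(2,3) d(1) by (intro exI[of _ "{(g, \<phi>)}"] exI[of _ d]) simp
  qed simp
  then obtain B d where B: "finite B" "B \<subseteq> V \<times> P" "0 < d" "nb B d \<subseteq> U"
    using f(1) by blast
  show ?thesis
  proof (rule that[OF B(1-3)])
    fix x assume "x \<in> V" and *: "\<And>g \<phi>. (g, \<phi>) \<in> B \<Longrightarrow> cmod (blinfun_apply \<phi> (ip g (x - f))) < d"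
    then have "x \<in> nb B d" using *[of "fst b" "snd b" for b] by (simp add: nb_def)
    then show "x \<in> U" using B(4) by blast
  qed
qed

lemma topspace_weak_star_topology: "topspace (weak_star_topology P V ip) = V"
proof -
  have "V \<in> {{f \<in> V. blinfun_apply \<phi> (ip g f) \<in> W} | g \<phi> W. g \<in> V \<and> \<phi> \<in> P \<and> open W}"
    using zero_in_predual by (auto intro!: exI[of _ 0] exI[of _ UNIV])
  then show ?thesis
    unfolding weak_star_topology_def topology_generated_by_topspace by blast
qed

lemma weak_closure_subset_closure_of:
  "N \<subseteq> V \<Longrightarrow> weak_closure N \<subseteq> weak_star_topology P V ip closure_of N"
proof
  fix f assume N: "N \<subseteq> V" and f: "f \<in> weak_closure N"
  then have fV: "f \<in> V" using weak_closure_subset by blast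
  show "f \<in> weak_star_topology P V ip closure_of N"
    unfolding in_closure_of topspace_weak_star_topology
  proof (intro conjI fV allI impI)
    fix U assume U: "f \<in> U \<and> openin (weak_star_topology P V ip) U"
    then obtain B d where B: "finite B" "B \<subseteq> V \<times> P" "0 < d"
      "\<And>x. x \<in> V \<Longrightarrow> (\<And>g \<phi>. (g, \<phi>) \<in> B \<Longrightarrow> cmod (blinfun_apply \<phi> (ip g (x - f))) < d) \<Longrightarrow> x \<in> U"
      using weak_star_topology_nbhd fV by metis
    obtain n where "n \<in> N" "\<And>g \<phi>. (g, \<phi>) \<in> B \<Longrightarrow> cmod (blinfun_apply \<phi> (ip g (n - f))) < d"
      using weak_closureD[OF f B(1-3)] by blast
    then show "\<exists>n. n \<in> N \<and> n \<in> U" using B(4) N by blast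
  qed
qed


section \<open>Operators between \<open>0\<close> and \<open>1\<close>\<close>

text \<open>
  The name is the one used in quantum theory for operators between \<open>0\<close> and \<open>1\<close>. Additivity,
  homogeneity and boundedness are consequences of the symmetry and the bounds.
\<close>
definition effect :: "('v \<Rightarrow> 'v) \<Rightarrow> bool" where
  "effect T \<longleftrightarrow> (\<forall>x\<in>V. T x \<in> V) \<and> (\<forall>x\<in>V. \<forall>y\<in>V. ip (T x) y = ip x (T y)) \<and>
     (\<forall>x\<in>V. nonneg (ip x (T x)) \<and> nonneg (ip x x - ip x (T x)))"

definition form_le :: "('v \<Rightarrow> 'v) \<Rightarrow> ('v \<Rightarrow> 'v) \<Rightarrow> bool" where
  "form_le T T' \<longleftrightarrow> (\<forall>x\<in>V. nonneg (ip x (T' x) - ip x (T x)))"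

lemma effect_closed [simp]: "effect T \<Longrightarrow> x \<in> V \<Longrightarrow> T x \<in> V"
  and effect_symmetric: "effect T \<Longrightarrow> x \<in> V \<Longrightarrow> y \<in> V \<Longrightarrow> ip (T x) y = ip x (T y)"
  and effect_nonneg: "effect T \<Longrightarrow> x \<in> V \<Longrightarrow> nonneg (ip x (T x))"
  and effect_le_one: "effect T \<Longrightarrow> x \<in> V \<Longrightarrow> nonneg (ip x x - ip x (T x))"
  by (simp_all add: effect_def)

lemma effect_diff: "effect T \<Longrightarrow> x \<in> V \<Longrightarrow> y \<in> V \<Longrightarrow> T (x - y) = T x - T y"
  by (rule eq_of_ip_eq) (simp_all add: effect_symmetric[symmetric] ip_diff_right)

lemma effect_add: "effect T \<Longrightarrow> x \<in> V \<Longrightarrow> y \<in> V \<Longrightarrow> T (x + y) = T x + T y"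
  by (rule eq_of_ip_eq) (simp_all add: effect_symmetric[symmetric] ip_add)

lemma effect_sc: "effect T \<Longrightarrow> x \<in> V \<Longrightarrow> T (sc c x) = sc c (T x)"
  by (rule eq_of_ip_eq) (simp_all add: effect_symmetric[symmetric] ip_sc)

lemma effect_act: "effect T \<Longrightarrow> x \<in> V \<Longrightarrow> T (act x a) = act (T x) a"
  by (rule eq_of_ip_eq) (simp_all add: effect_symmetric[symmetric] ip_act)

lemma form_le_trans: "form_le T1 T2 \<Longrightarrow> form_le T2 T3 \<Longrightarrow> form_le T1 T3"
  unfolding form_le_def
proof
  fix x assume "\<forall>x\<in>V. nonneg (ip x (T2 x) - ip x (T1 x))" "\<forall>x\<in>V. nonneg (ip x (T3 x) - ip x (T2 x))" "x \<in> V"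
  then have "nonneg ((ip x (T2 x) - ip x (T1 x)) + (ip x (T3 x) - ip x (T2 x)))"
    by (intro nonneg_add) auto
  then show "nonneg (ip x (T3 x) - ip x (T1 x))" by simp
qed

lemma form_le_refl: "form_le T T"
  by (simp add: form_le_def)

lemma form_le_antisym:
  assumes T: "effect T" "effect T'" and le: "form_le T T'" "form_le T' T" and x: "x \<in> V"
  shows "T x = T' x"
proof (rule eq_of_ip_eq)
  fix z assume z: "z \<in> V"
  have "ip z (T x) - ip z (T' x) = 0"
  proof (rule sesquilinear_eq_zero[where \<Phi> = "\<lambda>z x. ip z (T x) - ip z (T' x)"])
    fix y assume y: "y \<in> V"
    show "ip y (T y) - ip y (T' y) = 0"
      by (rule nonneg_antisym) (use le y in \<open>simp_all add: form_le_def\<close>)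
  qed (use T x z in \<open>simp_all add: effect_add effect_sc ip_add ip_sc ip_add_left ip_sc_left
      scaleC_diff_right\<close>)
  then show "ip z (T x) = ip z (T' x)" by simp
qed (use T x in auto)

text \<open>\<open>T - T\<^sup>2 = T (1 - T) T + (1 - T) T (1 - T)\<close>.\<close>
lemma effect_square_le:
  assumes T: "effect T" and x: "x \<in> V"
  shows "nonneg (ip x (T x) - ip (T x) (T x))"
proof -
  let ?y = "T x" and ?z = "x - T x"
  have "nonneg ((ip ?y ?y - ip ?y (T ?y)) + ip ?z (T ?z))"
    by (intro nonneg_add effect_le_one effect_nonneg T) (use T x in auto)
  moreover have "ip x (T ?y) = ip ?y ?y" by (rule effect_symmetric[symmetric]) (use T x in auto)
  ultimately show ?thesis
    using T x by (simp add: effect_diff ip_diff_left ip_diff_right)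
qed

lemma effect_norm_le:
  assumes T: "effect T" and x: "x \<in> V" and y: "y \<in> V"
  shows "norm (ip x (T y)) \<le> ip_norm ip x * ip_norm ip y"
proof -
  have "nonneg ((ip y (T y) - ip (T y) (T y)) + (ip y y - ip y (T y)))"
    by (intro nonneg_add effect_square_le effect_le_one T y)
  then have "nonneg (ip y y - ip (T y) (T y))" by simp
  then have "norm (ip (T y) (T y)) \<le> norm (ip y y)"
    by (intro norm_mono nonneg_ip) (use T y in auto)
  then have "ip_norm ip (T y) \<le> ip_norm ip y" by (simp add: ip_norm_def)
  then show ?thesis
    using Cauchy_Schwarz[OF x, of "T y"] T y mult_left_mono[of "ip_norm ip (T y)" "ip_norm ip y" "ip_norm ip x"]
    by simp
qed

end


section \<open>Infima of chains of operators on a self-dual module\<close>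

locale self_dual_module = wstar_hilbert_module e P V sc act ip
  for e :: "'a::cstar_algebra" and P and V :: "'v::ab_group_add set" and sc act ip +
  assumes self_dual: "bounded_module_map V sc act ip F \<Longrightarrow> \<exists>\<psi>\<in>V. \<forall>x\<in>V. F x = ip \<psi> x"
begin

text \<open>
  Along a refinement of the tail filter of the chain, all the matrix coefficients \<open>\<langle>g, T f\<rangle>\<close>
  converge weakly\<open>\<^sup>*\<close>, to a sesquilinear form \<open>S\<close>. Self-duality turns \<open>S\<close> into an operator provided
  that \<open>S(g, f a) = S(g, f) a\<close>. This is the crux, and it is here that monotonicity replaces the
  weak\<open>\<^sup>*\<close> continuity of multiplication: \<open>S(g, g)\<close> is the infimum of the \<open>\<langle>g, T g\<rangle>\<close> in the order of the
  algebra, and conjugation by an invertible element is an automorphism of the order. Hence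
  \<open>S(g u, g u) = star u * S(g, g) * u\<close> for invertible \<open>u\<close>. Taking \<open>u = 1 + c a\<close> with small complex
  \<open>c\<close> and comparing the coefficients of \<open>c\<close> gives the claim for \<open>f = g\<close>, and polarization does
  the rest.
\<close>
lemma effect_chain_infimum:
  assumes C: "C \<noteq> {}" "\<And>T. T \<in> C \<Longrightarrow> effect T"
    and chain: "\<And>T T'. T \<in> C \<Longrightarrow> T' \<in> C \<Longrightarrow> form_le T T' \<or> form_le T' T"
  obtains T G where "effect T" "\<And>T'. T' \<in> C \<Longrightarrow> form_le T T'" "\<And>x. x \<notin> V \<Longrightarrow> T x = 0"
    "G \<noteq> bot" "eventually (\<lambda>T'. T' \<in> C) G"
    "\<And>g f. g \<in> V \<Longrightarrow> f \<in> V \<Longrightarrow> weak_star_lim (\<lambda>T'. ip g (T' f)) (ip g (T f)) G"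
proof -
  define tails where "tails = (INF T\<in>C. principal {T' \<in> C. form_le T' T})"
  have dir: "\<exists>x\<in>C. principal {T' \<in> C. form_le T' x} \<le>
      inf (principal {T' \<in> C. form_le T' a}) (principal {T' \<in> C. form_le T' b})"
    if "a \<in> C" "b \<in> C" for a b
    using chain[OF that] that by (auto intro: form_le_trans)
  have ev_tails: "eventually Q tails \<longleftrightarrow> (\<exists>T\<in>C. \<forall>T'\<in>C. form_le T' T \<longrightarrow> Q T')" for Q
    unfolding tails_def by (subst eventually_INF_base[OF C(1) dir]) (auto simp: eventually_principal)
  have tails: "tails \<noteq> bot"
    unfolding trivial_limit_def ev_tails using form_le_refl by blast
  have ev_C: "eventually (\<lambda>T. T \<in> C) tails" unfolding ev_tails using C(1) by blast
  have ev_le: "eventually (\<lambda>T'. T' \<in> C \<and> form_le T' T) tails" if "T \<in> C" for T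
    unfolding ev_tails using that by blast
  have "eventually (\<lambda>T. \<forall>i\<in>V \<times> V. norm (ip (fst i) (T (snd i))) \<le> ip_norm ip (fst i) * ip_norm ip (snd i)) tails"
    using ev_C by eventually_elim (use C(2) effect_norm_le in auto)
  from weak_star_convergent_refinement[OF tails this]
  obtain G Y where G: "G \<le> tails" "G \<noteq> bot"
    and Y: "\<And>i. i \<in> V \<times> V \<Longrightarrow> weak_star_lim (\<lambda>T. ip (fst i) (T (snd i))) (Y i) G"
    by blast
  define S where "S g f = Y (g, f)" for g f
  have S: "weak_star_lim (\<lambda>T. ip g (T f)) (S g f) G" if "g \<in> V" "f \<in> V" for g f
    using Y[of "(g, f)"] that by (simp add: S_def)
  have G_C: "eventually (\<lambda>T. effect T \<and> T \<in> C) G"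
    using filter_leD[OF G(1) ev_C] by eventually_elim (use C(2) in auto)
  have G_le: "eventually (\<lambda>T'. effect T' \<and> form_le T' T) G" if "T \<in> C" for T
    using filter_leD[OF G(1) ev_le[OF that]] by eventually_elim (use C(2) in auto)
  have S_eqI: "S g f = a" if "g \<in> V" "f \<in> V" "weak_star_lim X a G"
      "\<And>T. effect T \<Longrightarrow> X T = ip g (T f)" for g f a X
    by (rule weak_star_lim_unique[OF G(2) S weak_star_lim_cong[OF that(3)]])
      (use that G_C in \<open>auto elim: eventually_mono\<close>)
  have S_add_right: "S g (f + h) = S g f + S g h" if "g \<in> V" "f \<in> V" "h \<in> V" for g f h
    by (rule S_eqI[OF _ _ weak_star_lim_add[OF S[of g f] S[of g h]]])
      (use that in \<open>simp_all add: effect_add ip_add\<close>)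
  have S_add_left: "S (g + h) f = S g f + S h f" if "g \<in> V" "f \<in> V" "h \<in> V" for g f h
    by (rule S_eqI[OF _ _ weak_star_lim_add[OF S[of g f] S[of h f]]])
      (use that in \<open>simp_all add: ip_add_left\<close>)
  have S_sc_right: "S g (sc c f) = c *\<^sub>C S g f" if "g \<in> V" "f \<in> V" for g f c
    by (rule S_eqI[OF _ _ weak_star_lim_scaleC[OF S[of g f]]])
      (use that in \<open>simp_all add: effect_sc ip_sc\<close>)
  have S_sc_left: "S (sc c g) f = cnj c *\<^sub>C S g f" if "g \<in> V" "f \<in> V" for g f c
    by (rule S_eqI[OF _ _ weak_star_lim_scaleC[OF S[of g f]]])
      (use that in \<open>simp_all add: ip_sc_left\<close>)
  have bounded: "eventually (\<lambda>T. norm (ip g (T f)) \<le> ip_norm ip g * ip_norm ip f) G"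
    if "g \<in> V" "f \<in> V" for g f
    using G_C by eventually_elim (use that effect_norm_le in auto)
  have S_nonneg: "nonneg (S g g)" if "g \<in> V" for g
    by (rule nonneg_weak_star_lim[OF G(2) S _ bounded])
      (use that G_C in \<open>auto elim!: eventually_mono simp: effect_nonneg\<close>)
  have S_lower: "nonneg (ip g (T g) - S g g)" if "g \<in> V" "T \<in> C" for g T
  proof (rule nonneg_weak_star_lim[OF G(2) weak_star_lim_diff[OF weak_star_lim_const S]])
    show "eventually (\<lambda>T'. nonneg (ip g (T g) - ip g (T' g))) G"
      using G_le[OF that(2)] by eventually_elim (use that in \<open>auto simp: form_le_def\<close>)
    show "eventually (\<lambda>T'. norm (ip g (T g) - ip g (T' g)) \<le>
        norm (ip g (T g)) + ip_norm ip g * ip_norm ip g) G"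
      using bounded[OF that(1) that(1)]
      by eventually_elim (use norm_triangle_ineq4 in \<open>smt (verit, best)\<close>)
  qed (use that in auto)
  have S_greatest: "nonneg (S g g - y)" if "g \<in> V" "\<And>T. T \<in> C \<Longrightarrow> nonneg (ip g (T g) - y)" for g y
  proof (rule nonneg_weak_star_lim[OF G(2) weak_star_lim_diff[OF S weak_star_lim_const]])
    show "eventually (\<lambda>T. nonneg (ip g (T g) - y)) G"
      using G_C by eventually_elim (use that in auto)
    show "eventually (\<lambda>T. norm (ip g (T g) - y) \<le> ip_norm ip g * ip_norm ip g + norm y) G"
      using bounded[OF that(1) that(1)]
      by eventually_elim (use norm_triangle_ineq4 in \<open>smt (verit, best)\<close>)
  qed (use that in auto)
  have S_star: "star (S g f) = S f g" if "g \<in> V" "f \<in> V" for g f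
  proof -
    have "star (S f g) - S g f = 0"
    proof (rule sesquilinear_eq_zero[where \<Phi> = "\<lambda>g f. star (S f g) - S g f"])
      fix x assume "x \<in> V"
      then show "star (S x x) - S x x = 0" using S_nonneg nonneg_selfadjoint by simp
    qed (use that in \<open>simp_all add: S_add_right S_add_left S_sc_right S_sc_left star_simps
        scaleC_diff_right\<close>)
    then show ?thesis by (metis eq_iff_diff_eq_0 star_star)
  qed
  \<comment> \<open>One half of the conjugation formula; exchanging \<open>a\<close> and \<open>b\<close> gives the other half.\<close>
  have transfer: "nonneg (S g g - star b * S (act g a) (act g a) * b)"
    if g: "g \<in> V" and ab: "a * b = e" for g a b
  proof (rule S_greatest[OF g])
    fix T assume T: "T \<in> C"
    have ba: "star b * star a = e" using ab by (metis star_mult star_unit)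
    have "nonneg (ip (act g a) (T (act g a)) - S (act g a) (act g a))"
      by (rule S_lower) (use g T in auto)
    then have "nonneg (star b * (ip (act g a) (T (act g a)) - S (act g a) (act g a)) * b)"
      by (rule nonneg_conjugate)
    moreover have "star b * ip (act g a) (T (act g a)) * b = ip g (T g)"
    proof -
      have "star b * ip (act g a) (T (act g a)) * b = (star b * star a) * ip g (T g) * (a * b)"
        using g C(2)[OF T] by (simp add: effect_act ip_act ip_act_left mult.assoc)
      then show ?thesis by (simp add: ab ba)
    qed
    ultimately show "nonneg (ip g (T g) - star b * S (act g a) (act g a) * b)"
      by (simp add: algebra_simps)
  qed
  have conj: "S (act g a) (act g a) = star a * S g g * a"
    if g: "g \<in> V" and ab: "a * b = e" and ba: "b * a = e" for g a b
  proof -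
    have sab: "star a * star b = e" using ba by (metis star_mult star_unit)
    have "nonneg (star a * (S g g - star b * S (act g a) (act g a) * b) * a)"
      by (rule nonneg_conjugate[OF transfer[OF g ab]])
    moreover have "star a * (star b * S (act g a) (act g a) * b) * a = (star a * star b) * S (act g a) (act g a) * (b * a)"
      by (simp add: mult.assoc)
    ultimately have "nonneg (star a * S g g * a - S (act g a) (act g a))"
      by (simp add: sab ba left_diff_distrib right_diff_distrib)
    moreover have "nonneg (S (act g a) (act g a) - star a * S g g * a)"
    proof -
      have "act (act g a) b = g" using g by (simp add: act_mult[symmetric] ab act_unit)
      then show ?thesis using transfer[of "act g a" b a] g ba by simp
    qed
    ultimately have "S (act g a) (act g a) - star a * S g g * a = 0"
      using nonneg_antisym by (metis minus_diff_eq)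
    then show ?thesis by simp
  qed
  have diag: "S g (act g a) = S g g * a" if g: "g \<in> V" for g a
  proof -
    \<comment> \<open>Small enough that \<open>1 + c a\<close> is invertible for \<open>cmod c = r\<close>. The values \<open>r\<close>, \<open>- r\<close> and
      \<open>i r\<close> of \<open>c\<close> suffice to separate the coefficients.\<close>
    define r where "r = 1 / (2 * (norm a + 1))"
    have r: "0 < r" by (simp add: r_def add_nonneg_pos)
    have ra: "r * norm a < 1" 
      by (simp add: r_def divide_less_eq add_nonneg_pos)
    let ?h = "act g a"
    let ?A = "S g ?h - S g g * a" and ?B = "S ?h g - star a * S g g"
      and ?E = "S ?h ?h - star a * S g g * a"
    have expand: "c *\<^sub>C ?A + cnj c *\<^sub>C ?B + (c * cnj c) *\<^sub>C ?E = 0" if c: "cmod c = r" for c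
    proof -
      let ?u = "e + c *\<^sub>C a"
      have "norm (c *\<^sub>C a) < 1" using ra c by (simp add: norm_scaleC)
      then obtain b where b: "?u * b = e" "b * ?u = e" using unit_plus_invertible by blast
      have u: "act g ?u = g + sc c ?h" using g by (simp add: act_add_right act_scaleC act_unit)
      have "S (g + sc c ?h) (g + sc c ?h) = star ?u * S g g * ?u"
        using conj[OF g b] by (simp add: u)
      moreover have "S (g + sc c ?h) (g + sc c ?h) =
          S g g + c *\<^sub>C S g ?h + cnj c *\<^sub>C S ?h g + (c * cnj c) *\<^sub>C S ?h ?h"
        using g by (simp add: S_add_left S_add_right S_sc_left S_sc_right scaleC_add_right
            scaleC_scaleC algebra_simps)
      moreover have "star ?u * S g g * ?u =
          S g g + c *\<^sub>C (S g g * a) + cnj c *\<^sub>C (star a * S g g) + (c * cnj c) *\<^sub>C (star a * S g g * a)"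
        by (simp add: star_simps distrib_left distrib_right scaleC_mult scaleC_add_right scaleC_scaleC
            mult.assoc add_ac mult.commute[of c])
      ultimately show ?thesis by (simp add: scaleC_diff_right algebra_simps)
    qed
    have 1: "complex_of_real r *\<^sub>C ?A + complex_of_real r *\<^sub>C ?B + complex_of_real (r * r) *\<^sub>C ?E = 0"
      using expand[of "complex_of_real r"] r by simp
    have 2: "- (complex_of_real r *\<^sub>C ?A) - complex_of_real r *\<^sub>C ?B + complex_of_real (r * r) *\<^sub>C ?E = 0"
      using expand[of "- complex_of_real r"] r by (simp add: scaleC_minus_left)
    have 3: "\<i> *\<^sub>C (complex_of_real r *\<^sub>C ?A - complex_of_real r *\<^sub>C ?B) + complex_of_real (r * r) *\<^sub>C ?E = 0"
    proof -
      have "\<i> * complex_of_real r * cnj (\<i> * complex_of_real r) = complex_of_real (r * r)"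
        by (simp add: complex_eq_iff)
      moreover have "\<i> *\<^sub>C (complex_of_real r *\<^sub>C x - complex_of_real r *\<^sub>C y) =
          (\<i> * complex_of_real r) *\<^sub>C x + cnj (\<i> * complex_of_real r) *\<^sub>C y" for x y :: 'a
        by (simp add: scaleC_minus_left scaleC_diff_right scaleC_scaleC)
      ultimately show ?thesis
        using expand[of "\<i> * complex_of_real r"] r by (simp add: norm_mult)
    qed
    let ?X = "r *\<^sub>R ?A" and ?Y = "r *\<^sub>R ?B" and ?Z = "(r * r) *\<^sub>R ?E"
    have 1: "?X + ?Y + ?Z = 0" and 2: "- ?X - ?Y + ?Z = 0" and 3: "\<i> *\<^sub>C (?X - ?Y) + ?Z = 0"
      using 1 2 3 by (simp_all only: scaleR_scaleC)
    have "?Z + ?Z = (?X + ?Y + ?Z) + (- ?X - ?Y + ?Z)" by simp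
    then have "2 *\<^sub>R ?Z = 0" unfolding scaleR_2 using 1 2 by simp
    then have Z: "?Z = 0" by simp
    have XY: "?X + ?Y = 0" using 1 unfolding Z by simp
    have "- \<i> *\<^sub>C \<i> *\<^sub>C (?X - ?Y) = 0" using 3 Z by simp
    then have "?X - ?Y = 0" by (simp only: scaleC_scaleC) (simp add: scaleC_one)
    then have "2 *\<^sub>R ?X = 0" unfolding scaleR_2 using XY by (metis right_minus_eq)
    then show ?thesis using r by simp
  qed
  have S_act: "S g (act f a) = S g f * a" if "g \<in> V" "f \<in> V" for g f a
  proof -
    have "S g (act f a) - S g f * a = 0"
      by (rule sesquilinear_eq_zero[where \<Phi> = "\<lambda>g f. S g (act f a) - S g f * a"])
        (use that in \<open>simp_all add: act_add_left act_sc S_add_right S_add_left S_sc_right S_sc_left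
          diag distrib_right scaleC_mult scaleC_diff_right\<close>)
    then show ?thesis by simp
  qed
  have "\<exists>\<psi>\<in>V. \<forall>g\<in>V. S f g = ip \<psi> g" if f: "f \<in> V" for f
  proof (rule self_dual)
    have "norm (S f g) \<le> ip_norm ip f * ip_norm ip g" if "g \<in> V" for g
      by (rule norm_weak_star_lim_le[OF G(2) S bounded]) (use f that in auto)
    then show "bounded_module_map V sc act ip (S f)"
      using f by (auto simp: bounded_module_map_def S_add_right S_sc_right S_act)
  qed
  then obtain R where R: "\<And>f. f \<in> V \<Longrightarrow> R f \<in> V" "\<And>f g. f \<in> V \<Longrightarrow> g \<in> V \<Longrightarrow> S f g = ip (R f) g"
    by metis
  define T where "T f = (if f \<in> V then R f else 0)" for f
  have T_left: "ip (T f) g = S f g" and T_right: "ip g (T f) = S g f" if "f \<in> V" "g \<in> V" for f g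
    using R that S_star[of f g] by (simp_all add: T_def ip_star)
  show ?thesis
  proof (rule that[of T, OF _ _ _ G(2)])
    show "effect T"
      unfolding effect_def
    proof (intro conjI ballI)
      fix x assume x: "x \<in> V"
      show "T x \<in> V" using x R by (simp add: T_def)
      show "nonneg (ip x (T x))" using S_nonneg x by (simp add: T_right)
      obtain T0 where T0: "T0 \<in> C" using C(1) by blast
      have "nonneg ((ip x x - ip x (T0 x)) + (ip x (T0 x) - S x x))"
        by (intro nonneg_add effect_le_one S_lower C T0 x)
      then show "nonneg (ip x x - ip x (T x))" using x by (simp add: T_right)
      show "ip (T x) y = ip x (T y)" if "y \<in> V" for y using x that by (simp add: T_left T_right)
    qed
    show "form_le T T'" if "T' \<in> C" for T' using that S_lower by (simp add: form_le_def T_right)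
    show "T x = 0" if "x \<notin> V" for x using that by (simp add: T_def)
    show "eventually (\<lambda>T'. T' \<in> C) G" using G_C by eventually_elim simp
    show "weak_star_lim (\<lambda>T'. ip g (T' f)) (ip g (T f)) G" if "g \<in> V" "f \<in> V" for g f
      using S that by (simp add: T_right)
  qed
qed

text \<open>
  Consider the operators \<open>0 \<le> T \<le> 1\<close> for which \<open>f - T f\<close> always lies in the weak\<open>\<^sup>*\<close> closure of
  \<open>N\<close>. By the previous lemma there is a minimal one \<open>T\<close>. For \<open>n \<in> N\<close> and small \<open>c > 0\<close> the operator
  \<open>T (1 - c n\<langle>n, \<cdot>\<rangle>) T\<close> is another one; it lies below \<open>T\<^sup>2\<close> and hence below \<open>T\<close>. Minimality gives
  \<open>\<langle>n, T x\<rangle> = 0\<close>, so the range of \<open>T\<close> is orthogonal to \<open>N\<close> and \<open>T = 0\<close>.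
\<close>
theorem weak_closure_eq_of_orthogonal_zero:
  assumes N: "submodule sc act N" "N \<subseteq> V"
    and orth: "\<And>x. x \<in> V \<Longrightarrow> (\<And>n. n \<in> N \<Longrightarrow> ip n x = 0) \<Longrightarrow> x = 0"
  shows "weak_closure N = V"
proof -
  let ?W = "weak_closure N"
  have N0: "0 \<in> N" and Nadd: "\<And>x y. x \<in> N \<Longrightarrow> y \<in> N \<Longrightarrow> x + y \<in> N"
    and Nsc: "\<And>x c. x \<in> N \<Longrightarrow> sc c x \<in> N" and Nact: "\<And>x a. x \<in> N \<Longrightarrow> act x a \<in> N"
    using N(1) by (auto simp: submodule_def)
  have Ndiff: "x - y \<in> N" if "x \<in> N" "y \<in> N" for x y
    using Nadd[OF that(1) Nsc[OF that(2), of "- 1"]] that N(2) by (auto simp: sc_minus_one)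
  have Wdiff: "x - y \<in> ?W" if "x \<in> ?W" "y \<in> ?W" for x y
    by (rule weak_closure_diff[OF N(2)]) (use Ndiff that in auto)
  have NW: "n \<in> ?W" if "n \<in> N" for n using subset_weak_closure[OF N(2)] that by blast
  have Wadd: "x + y \<in> ?W" if "x \<in> ?W" "y \<in> ?W" for x y
    using Wdiff[OF that(1) Wdiff[OF NW[OF N0] that(2)]] by simp
  \<comment> \<open>The value \<open>0\<close> outside \<open>V\<close> makes the order on \<open>Q\<close> antisymmetric.\<close>
  define Q where "Q = {T. effect T \<and> (\<forall>x. x \<notin> V \<longrightarrow> T x = 0) \<and> (\<forall>x\<in>V. x - T x \<in> ?W)}"
  let ?ge = "\<lambda>T T'. form_le T' T"
  have "\<exists>T\<in>Q. \<forall>T'\<in>Q. ?ge T T' \<longrightarrow> T' = T"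
  proof (rule predicate_Zorn)
    show "partial_order_on Q (relation_of ?ge Q)"
    proof (rule partial_order_on_relation_ofI)
      show "?ge T T" for T by (rule form_le_refl)
      show "?ge T1 T3" if "?ge T1 T2" "?ge T2 T3" for T1 T2 T3 using that form_le_trans by blast
      show "T = T'" if "T \<in> Q" "T' \<in> Q" "?ge T T'" "?ge T' T" for T T'
      proof
        fix x
        show "T x = T' x"
          using that form_le_antisym[of T T' x] by (cases "x \<in> V") (auto simp: Q_def)
      qed
    qed
    fix C assume C: "C \<in> Chains (relation_of ?ge Q)"
    then have chain: "form_le T T' \<or> form_le T' T" if "T \<in> C" "T' \<in> C" for T T'
      using that by (auto simp: Chains_def relation_of_def)
    have CQ: "C \<subseteq> Q" using C by (auto simp: Chains_def relation_of_def)
    show "\<exists>u\<in>Q. \<forall>a\<in>C. ?ge a u"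
    proof (cases "C = {}")
      case True
      have "effect (\<lambda>x. if x \<in> V then x else 0)"
        by (simp add: effect_def nonneg_ip)
      then have "(\<lambda>x. if x \<in> V then x else 0) \<in> Q" using NW[OF N0] by (simp add: Q_def)
      then show ?thesis using True by blast
    next
      case False
      obtain T G where T: "effect T" "\<And>T'. T' \<in> C \<Longrightarrow> form_le T T'" "\<And>x. x \<notin> V \<Longrightarrow> T x = 0"
        and G: "G \<noteq> bot" "eventually (\<lambda>T'. T' \<in> C) G"
          "\<And>g f. g \<in> V \<Longrightarrow> f \<in> V \<Longrightarrow> weak_star_lim (\<lambda>T'. ip g (T' f)) (ip g (T f)) G"
        by (rule effect_chain_infimum[OF False _ chain]) (use CQ in \<open>auto simp: Q_def\<close>)
      have "x - T x \<in> ?W" if x: "x \<in> V" for x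
      proof (rule weak_closure_limit[OF N(2) _ G(1)])
        show "x - T x \<in> V" using x T by simp
        show "eventually (\<lambda>T'. x - T' x \<in> ?W) G"
          using G(2) by eventually_elim (use CQ x in \<open>auto simp: Q_def\<close>)
        show "weak_star_lim (\<lambda>T'. ip g (x - T' x)) (ip g (x - T x)) G" if g: "g \<in> V" for g
        proof (rule weak_star_lim_cong)
          show "weak_star_lim (\<lambda>T'. ip g x - ip g (T' x)) (ip g (x - T x)) G"
            using weak_star_lim_diff[OF weak_star_lim_const G(3)[OF g x], of "ip g x"] g x T(1)
            by (simp add: ip_diff_right)
          show "eventually (\<lambda>T'. ip g x - ip g (T' x) = ip g (x - T' x)) G"
            using G(2) by eventually_elim (use CQ x g in \<open>auto simp: Q_def ip_diff_right\<close>)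
        qed
      qed
      then have "T \<in> Q" using T by (simp add: Q_def)
      then show ?thesis using T(2) by blast
    qed
  qed
  then obtain T where TQ: "T \<in> Q" and min: "\<And>T'. T' \<in> Q \<Longrightarrow> form_le T' T \<Longrightarrow> T' = T" by blast
  have T: "effect T" and T0: "\<And>x. x \<notin> V \<Longrightarrow> T x = 0" and TW: "\<And>x. x \<in> V \<Longrightarrow> x - T x \<in> ?W"
    using TQ by (auto simp: Q_def)
  have perp: "ip n (T x) = 0" if n: "n \<in> N" and x: "x \<in> V" for n x
  proof -
    have nV: "n \<in> V" using n N by blast
    \<comment> \<open>By the Cauchy-Schwarz inequality \<open>c n\<langle>n, \<cdot>\<rangle> \<le> 1\<close> for this \<open>c\<close>.\<close>
    define c where "c = 1 / (norm (ip n n) + 1)"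
    have c: "0 < c" "c * norm (ip n n) \<le> 1" by (simp_all add: c_def add_nonneg_pos)
    define q where "q y = act n (c *\<^sub>R ip n y)" for y
    define T1 where "T1 y = (if y \<in> V then T (T y - q (T y)) else 0)" for y
    have qN: "q y \<in> N" for y using Nact n by (simp add: q_def)
    then have qV [simp]: "q y \<in> V" for y using N by blast
    have ip_q: "ip z (q y) = c *\<^sub>R (ip z n * ip n y)" if "z \<in> V" "y \<in> V" for y z
      using that nV by (simp add: q_def ip_act)
    have q_ip: "ip (q y) z = c *\<^sub>R (ip y n * ip n z)" if "z \<in> V" "y \<in> V" for y z
      using that nV by (simp add: q_def ip_act_left star_simps ip_star)
    have form: "ip y (T1 z) = ip (T y) (T z) - c *\<^sub>R (ip (T y) n * ip n (T z))"
      if "y \<in> V" "z \<in> V" for y z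
      using that T by (simp add: T1_def effect_symmetric[symmetric] ip_diff_right ip_q)
    have form': "ip (T1 y) z = ip (T y) (T z) - c *\<^sub>R (ip (T y) n * ip n (T z))"
      if "y \<in> V" "z \<in> V" for y z
      using that T by (simp add: T1_def effect_symmetric[of T "T y - q (T y)"] ip_diff_left q_ip)
    have le: "form_le T1 T"
      unfolding form_le_def
    proof
      fix y assume y: "y \<in> V"
      have "nonneg ((ip y (T y) - ip (T y) (T y)) + c *\<^sub>R (ip (T y) n * ip n (T y)))"
        by (intro nonneg_add effect_square_le nonneg_scaleR nonneg_ip_ip) (use T y nV c in auto)
      then show "nonneg (ip y (T y) - ip y (T1 y))" by (simp add: form y algebra_simps)
    qed
    have "effect T1"
      unfolding effect_def
    proof (intro conjI ballI)
      fix y assume y: "y \<in> V"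
      let ?y = "T y"
      show "T1 y \<in> V" using y T by (simp add: T1_def)
      show "ip (T1 y) z = ip y (T1 z)" if "z \<in> V" for z
        using y that by (simp add: form form')
      have "nonneg (c *\<^sub>R (norm (ip n n) *\<^sub>R ip ?y ?y - ip ?y n * ip n ?y) +
          (1 - c * norm (ip n n)) *\<^sub>R ip ?y ?y)"
        by (intro nonneg_add nonneg_scaleR Cauchy_Schwarz_nonneg nonneg_ip) (use T y nV c in auto)
      then show "nonneg (ip y (T1 y))" by (simp add: form y algebra_simps)
      have "nonneg ((ip y y - ip y (T y)) + (ip y (T y) - ip y (T1 y)))"
        by (rule nonneg_add) (use le T y in \<open>auto simp: form_le_def effect_le_one\<close>)
      then show "nonneg (ip y y - ip y (T1 y))" by simp
    qed
    moreover have "y - T1 y \<in> ?W" if y: "y \<in> V" for y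
    proof -
      let ?q = "q (T y)"
      \<comment> \<open>In this form the last summand \<open>T q(T y)\<close> is seen to lie in the closure, as a difference of
        an element of \<open>N\<close> and a value of \<open>1 - T\<close>.\<close>
      have eq: "y - T1 y = (y - T y) + (T y - T (T y)) + (?q - (?q - T ?q))"
        using y T by (simp add: T1_def effect_diff)
      show ?thesis
        unfolding eq by (rule Wadd[OF Wadd[OF TW TW] Wdiff[OF NW[OF qN] TW]]) (use y T in auto)
    qed
    ultimately have "T1 \<in> Q" by (simp add: Q_def T1_def)
    then have "T1 = T" using min le by blast
    then have eq: "ip x (T x) = ip (T x) (T x) - c *\<^sub>R (ip (T x) n * ip n (T x))"
      using form[OF x x] by simp
    have "nonneg (c *\<^sub>R (ip (T x) n * ip n (T x)))"
      by (intro nonneg_scaleR nonneg_ip_ip) (use T x nV c in auto)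
    moreover have "nonneg (- (c *\<^sub>R (ip (T x) n * ip n (T x))))"
      using effect_square_le[OF T x] by (simp add: eq)
    ultimately have "c *\<^sub>R (ip (T x) n * ip n (T x)) = 0" by (rule nonneg_antisym)
    then have "star (ip n (T x)) * ip n (T x) = 0" using c T x nV by (simp add: ip_star)
    then show ?thesis using cstar_identity[of "ip n (T x)"] by simp
  qed
  have "x \<in> ?W" if x: "x \<in> V" for x
    using orth[of "T x"] perp x T TW[OF x] by simp
  then show ?thesis using weak_closure_subset by blast
qed

end


section \<open>From relative kernels to kernels\<close>

text \<open>
  A bounded module map on the target is pulled back along \<open>U\<close>, and the vector that represents it is
  pushed forward. This moves self-duality from the dual module to its realization by functions.
\<close>
lemma self_dual_of_module_unitary:
  assumes U: "module_unitary V sc act ip V' sc' act' ip' U"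
    and self_dual: "\<And>F. bounded_module_map V sc act ip F \<Longrightarrow> \<exists>\<psi>\<in>V. \<forall>x\<in>V. F x = ip \<psi> x"
    and F: "bounded_module_map V' sc' act' ip' F"
  shows "\<exists>\<psi>\<in>V'. \<forall>x\<in>V'. F x = ip' \<psi> x"
proof -
  have bij: "bij_betw U V V'"
    and U_simps: "\<And>x y. x \<in> V \<Longrightarrow> y \<in> V \<Longrightarrow> U (x + y) = U x + U y"
      "\<And>x c. x \<in> V \<Longrightarrow> U (sc c x) = sc' c (U x)"
      "\<And>x a. x \<in> V \<Longrightarrow> U (act x a) = act' (U x) a"
      "\<And>x y. x \<in> V \<Longrightarrow> y \<in> V \<Longrightarrow> ip' (U x) (U y) = ip x y"
    using U unfolding module_unitary_def by blast+
  have UV: "U x \<in> V'" if "x \<in> V" for x using bij that by (auto simp: bij_betw_def)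
  obtain C where C: "\<And>x. x \<in> V' \<Longrightarrow> norm (F x) \<le> C * ip_norm ip' x"
    using F unfolding bounded_module_map_def by blast
  have "norm (F (U x)) \<le> C * ip_norm ip x" if "x \<in> V" for x
    using C[OF UV[OF that]] that by (simp add: ip_norm_def U_simps)
  then have "bounded_module_map V sc act ip (\<lambda>x. F (U x))"
    using F unfolding bounded_module_map_def by (auto simp: U_simps UV)
  then obtain \<psi> where \<psi>: "\<psi> \<in> V" "\<And>x. x \<in> V \<Longrightarrow> F (U x) = ip \<psi> x" using self_dual by blast
  have "F y = ip' (U \<psi>) y" if y: "y \<in> V'" for y
  proof -
    obtain x where "x \<in> V" "y = U x" using bij y unfolding bij_betw_def by blast
    then show ?thesis using \<psi> by (simp add: U_simps)
  qed
  then show ?thesis using UV \<psi>(1) by blast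
qed

text \<open>As in a normed space, continuity at \<open>0\<close> and homogeneity give boundedness.\<close>
lemma (in unital_hilbert_module) bounded_of_continuous_map:
  assumes cont: "continuous_map (Metric_space.mtopology V (ip_dist V ip)) euclidean F"
    and scale: "\<And>x c. x \<in> V \<Longrightarrow> F (sc c x) = c *\<^sub>C (F x :: 'a)"
  shows "\<exists>C. \<forall>x\<in>V. norm (F x) \<le> C * ip_norm ip x"
proof -
  interpret metric: Metric_space V "ip_dist V ip" by (rule metric_space)
  have F0: "F 0 = 0"
  proof -
    have "sc 0 0 = 0" using sc_add_left[of 0 0 0] by simp
    then show ?thesis using scale[of 0 0] by simp
  qed
  have "openin metric.mtopology {x \<in> V. F x \<in> ball 0 1}"
    using openin_continuous_map_preimage[OF cont, of "ball 0 1"] by simp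
  then obtain r where r: "0 < r" "metric.mball 0 r \<subseteq> {x \<in> V. F x \<in> ball 0 1}"
    using F0 unfolding metric.openin_mtopology by (metis (mono_tags, lifting) centre_in_ball mem_Collect_eq zero_closed zero_less_one)
  have small: "norm (F x) < 1" if "x \<in> V" "ip_norm ip x < r" for x
  proof -
    have "x \<in> metric.mball 0 r" using that by (simp add: ip_dist_def ip_norm_minus)
    then show ?thesis using r(2) by auto
  qed
  have "norm (F x) \<le> (2 / r) * ip_norm ip x" if x: "x \<in> V" for x
  proof (cases "x = 0")
    case True
    then show ?thesis using F0 r by simp
  next
    case False
    then have N: "0 < ip_norm ip x"
      using ip_norm_eq_zero[OF x] ip_norm_nonneg[of x] by linarith
    define c where "c = r / (2 * ip_norm ip x)"
    have c: "0 < c" using N r by (simp add: c_def)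
    have "ip_norm ip (sc (complex_of_real c) x) = r / 2"
      using x N c by (simp add: ip_norm_sc) (simp add: c_def)
    then have "norm (F (sc (complex_of_real c) x)) < 1" using small x r by simp
    then have "c * norm (F x) < 1" using c x by (simp add: scale norm_scaleC)
    then show ?thesis using N r by (simp add: c_def field_simps)
  qed
  then show ?thesis by blast
qed

lemma (in unital_hilbert_module) sum_closed: "(\<And>i. i \<in> I \<Longrightarrow> f i \<in> V) \<Longrightarrow> sum f I \<in> V"
  by (induction I rule: infinite_finite_induct) auto

lemma (in unital_hilbert_module) ip_sum_right:
  "x \<in> V \<Longrightarrow> (\<And>i. i \<in> I \<Longrightarrow> f i \<in> V) \<Longrightarrow> ip x (sum f I) = (\<Sum>i\<in>I. ip x (f i))"
  by (induction I rule: infinite_finite_induct) (auto simp: ip_add sum_closed)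

lemma (in unital_hilbert_module) ip_sum_left:
  "x \<in> V \<Longrightarrow> (\<And>i. i \<in> I \<Longrightarrow> f i \<in> V) \<Longrightarrow> ip (sum f I) x = (\<Sum>i\<in>I. ip (f i) x)"
  by (induction I rule: infinite_finite_induct) (auto simp: ip_add_left sum_closed)

theorem theorem4p5:
  fixes P :: "('a::cstar_algebra \<Rightarrow>\<^sub>L complex) set"
    and actH :: "'h::complex_vector \<Rightarrow> 'a \<Rightarrow> 'h"
    and ipH :: "'h \<Rightarrow> 'h \<Rightarrow> 'a"
    and ipH' :: "('h \<Rightarrow> 'a) \<Rightarrow> ('h \<Rightarrow> 'a) \<Rightarrow> 'a"
    and actE :: "'e::complex_vector \<Rightarrow> 'a \<Rightarrow> 'e"
    and ipE :: "'e \<Rightarrow> 'e \<Rightarrow> 'a"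
    and M :: "('s \<Rightarrow> 'e) set"
    and ipM :: "('s \<Rightarrow> 'e) \<Rightarrow> ('s \<Rightarrow> 'e) \<Rightarrow> 'a"
    and U :: "('h \<Rightarrow> 'a) \<Rightarrow> ('s \<Rightarrow> 'e)"
    and D :: "'e \<Rightarrow> 's \<Rightarrow> 's \<Rightarrow> ('s \<Rightarrow> 'e)"
    and s\<^sub>0 :: 's
  assumes wstar_algebra: "wstar_predual P"
    and hilbert_H: "hilbert_module UNIV scaleC actH ipH"
    and dual_H: "dual_inner_product actH ipH ipH'"
    and hilbert_E: "hilbert_module UNIV scaleC actE ipE"
    and dual_as_functions:
      "module_unitary (dual_module actH ipH) dual_scale dual_act ipH'
                      M fun_scale (fun_act actE) ipM U"
    and relative_kernel: "relative_reproducing_kernel actE ipE M ipM D"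
    and evaluation_continuous:
      "\<forall>x. continuous_map (Metric_space.mtopology M (ip_dist M ipM)) euclidean (\<lambda>f. ipE x (f s\<^sub>0))"
  shows "\<exists>K :: 's \<Rightarrow> 's \<Rightarrow> 'e \<Rightarrow> 'e.
           reproducing_kernel_module P actE ipE M ipM K \<and>
           (\<forall>x s t. D x s t = kernel_section K x s - kernel_section K x t)"
proof -
  have "\<exists>e::'a. \<forall>a. e * a = a \<and> a * e = a"
    using wstar_algebra unfolding wstar_predual_def by (elim conjE)
  then obtain e :: 'a where e: "\<And>a. e * a = a" "\<And>a. a * e = a" by blast
  have M: "hilbert_module M fun_scale (fun_act actE) ipM"
    and D: "\<And>x s t. D x s t \<in> M" "\<And>f x s t. f \<in> M \<Longrightarrow> ipE (f s - f t) x = ipM f (D x s t)"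
    using relative_kernel by (auto simp: relative_reproducing_kernel_def function_hilbert_module_def)
  have dual: "\<exists>\<psi>\<in>dual_module actH ipH. \<forall>\<tau>\<in>dual_module actH ipH. F \<tau> = ipH' \<psi> \<tau>"
    if "bounded_module_map (dual_module actH ipH) dual_scale dual_act ipH' F" for F
    using dual_H that unfolding dual_inner_product_def by blast
  interpret E: unital_hilbert_module e UNIV scaleC actE ipE
    by (intro unital_hilbert_module.intro unital_cstar_algebra.intro hilbert_E e)
  interpret M: self_dual_module e P M fun_scale "fun_act actE" ipM
  proof (intro self_dual_module.intro wstar_hilbert_module.intro wstar_algebra.intro
      wstar_algebra_axioms.intro self_dual_module_axioms.intro unital_hilbert_module.intro
      unital_cstar_algebra.intro e M wstar_algebra)
    show "\<exists>\<psi>\<in>M. \<forall>f\<in>M. F f = ipM \<psi> f" if "bounded_module_map M fun_scale (fun_act actE) ipM F" for F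
      by (rule self_dual_of_module_unitary[OF dual_as_functions dual that])
  qed
  have "\<exists>k\<in>M. \<forall>f\<in>M. ipE x (f s\<^sub>0) = ipM k f" for x
  proof (rule M.self_dual)
    have "\<exists>C. \<forall>f\<in>M. norm (ipE x (f s\<^sub>0)) \<le> C * ip_norm ipM f"
      by (rule M.bounded_of_continuous_map[OF evaluation_continuous[THEN spec, of x]])
        (simp add: fun_scale_def E.ip_sc)
    then show "bounded_module_map M fun_scale (fun_act actE) ipM (\<lambda>f. ipE x (f s\<^sub>0))"
      by (simp add: bounded_module_map_def fun_scale_def fun_act_def E.ip_sc E.ip_add E.ip_act)
  qed
  then obtain k where k: "\<And>x. k x \<in> M" "\<And>x f. f \<in> M \<Longrightarrow> ipE x (f s\<^sub>0) = ipM (k x) f"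
    by metis
  define K where "K s t x = (D x s s\<^sub>0 + k x) t" for s t x
  \<comment> \<open>\<open>K\<^bsub>x,s\<^esub>\<close> is the vector representing \<open>f \<mapsto> \<langle>f(s), x\<rangle> = \<langle>f(s) - f(s\<^sub>0), x\<rangle> + \<langle>f(s\<^sub>0), x\<rangle>\<close>.\<close>
  have section_eq: "kernel_section K x s = D x s s\<^sub>0 + k x" for x s
    by (simp add: kernel_section_def K_def fun_eq_iff)
  have section_M: "kernel_section K x s \<in> M" for x s
    by (simp add: section_eq D k)
  have reproducing: "ipE (f s) x = ipM f (kernel_section K x s)" if f: "f \<in> M" for f x s
  proof -
    have "ipE (f s) x = ipE (f s - f s\<^sub>0) x + star (ipE x (f s\<^sub>0))"
      by (simp add: E.ip_diff_left E.ip_star)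
    also have "\<dots> = ipM f (D x s s\<^sub>0) + ipM f (k x)"
      using f k D by (simp add: M.ip_star)
    finally show ?thesis using f k D by (simp add: section_eq M.ip_add)
  qed
  have gram: "ipM (kernel_section K x s) (kernel_section K y t) = ipE (K s t x) y" for x y s t
    using reproducing[OF section_M[of x s], of t y] by (simp add: kernel_section_def)
  have adjoint: "is_adjoint ipE (K s t) (K t s)" for s t
    unfolding is_adjoint_def
  proof (intro allI)
    fix x y
    have "ipE (K s t x) y = star (ipM (kernel_section K y t) (kernel_section K x s))"
      by (simp add: gram[symmetric] M.ip_star section_M)
    then show "ipE (K s t x) y = ipE x (K t s y)" by (simp add: gram E.ip_star)
  qed
  have "positive (\<Sum>i=1..n. \<Sum>j=1..n. ipE (K (s i) (s j) (x i)) (x j))"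
    for n and s :: "nat \<Rightarrow> 's" and x :: "nat \<Rightarrow> 'e"
  proof -
    let ?f = "\<lambda>i. kernel_section K (x i) (s i)"
    have sum_M: "sum ?f {1..n} \<in> M" by (rule M.sum_closed) (rule section_M)
    have "ipM (sum ?f {1..n}) (sum ?f {1..n}) = (\<Sum>i=1..n. ipM (?f i) (sum ?f {1..n}))"
      by (rule M.ip_sum_left[OF sum_M]) (rule section_M)
    also have "\<dots> = (\<Sum>i=1..n. \<Sum>j=1..n. ipM (?f i) (?f j))"
      by (intro sum.cong refl M.ip_sum_right section_M)
    finally show ?thesis using M.ip_positive[OF sum_M] by (simp add: gram)
  qed
  then have pos: "positive_definite_kernel ipE K"
    using adjoint unfolding positive_definite_kernel_def adjointable_def by blast
  let ?N = "submodule fun_scale (fun_act actE) hull {kernel_section K x s | x s. True}"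
  have N: "submodule fun_scale (fun_act actE) ?N"
    by (rule hull_in) (auto simp: submodule_def)
  have NM: "?N \<subseteq> M"
    by (rule hull_minimal) (use section_M M.closed_operations in auto)
  have "M.weak_closure ?N = M"
  proof (rule M.weak_closure_eq_of_orthogonal_zero[OF N NM])
    fix f assume f: "f \<in> M" and orth: "\<And>n. n \<in> ?N \<Longrightarrow> ipM n f = 0"
    have "f s = 0" for s
    proof (rule E.ip_definite)
      have "kernel_section K (f s) s \<in> ?N" by (rule hull_inc) blast
      then have "star (ipM (kernel_section K (f s) s) f) = 0" using orth by simp
      then show "ipE (f s) (f s) = 0" using f by (simp add: reproducing M.ip_star section_M)
    qed simp
    then show "f = 0" by (simp add: fun_eq_iff)
  qed
  then have dense: "weak_star_topology P M ipM closure_of ?N = M"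
    using M.weak_closure_subset_closure_of[OF NM] closure_of_subset_topspace[of "weak_star_topology P M ipM" ?N]
    by (simp add: M.topspace_weak_star_topology)
  have "D x s t = kernel_section K x s - kernel_section K x t" for x s t
  proof (rule M.eq_of_ip_eq)
    fix f assume f: "f \<in> M"
    then have "ipM f (D x s t) = ipE (f s) x - ipE (f t) x"
      by (simp add: D(2)[symmetric] E.ip_diff_left)
    then show "ipM f (D x s t) = ipM f (kernel_section K x s - kernel_section K x t)"
      using f by (simp add: reproducing M.ip_diff_right section_M)
  qed (simp_all add: D section_M)
  moreover have "reproducing_kernel_module P actE ipE M ipM K"
    unfolding reproducing_kernel_module_def function_hilbert_module_def
    using M pos section_M dense gram reproducing by blast
  ultimately show ?thesis by blast
qed

end
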